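(* Let $(X_t)_{t=-\infty}^\infty$ be a centred weakly stationary real time series with $\mathbb{E}X_t^2\leqslant 1$. Let $\{\varphi_k\}_{k=1}^\infty$ be a non-increasing sequence of non-negative numbers such that, for all integers $i<j<k<l$, $$|\mathrm{Cov}(X_i,X_jX_kX_l)|\leqslant \varphi_{j-i},\quad |\mathrm{Cov}(X_iX_jX_k,X_l)|\leqslant \varphi_{l-k},$$ $$|\mathrm{Cov}(X_iX_j,X_kX_l)|\leqslant \varphi_{k-j},\quad |\mathrm{Cov}(X_i,X_j)|\leqslant \varphi_{j-i},$$ and let $\{\phi_k\}_{k=1}^\infty$ be a sequence of non-negative numbers such that $\mathrm{Cov}(X_i^2,X_j^2)\leqslant \phi_{j-i}$ for all integers $i<j$. Let $\Phi_0=\sup_t\mathbb{E}X_t^4$, $\Phi_1=\sum_{k=1}^\infty k\varphi_k$ and $\Phi_2=\sum_{k=1}^\infty\phi_k$. Let $K:[0,\infty)\to\mathbb{R}$ satisfy (a) $K(0)=1$, $K$ is continuous at $x=0$, and $\sup_{x\geqslant 0}|K(x)|<\infty$; (b) $\int_0^\infty \bar{K}^2(x)\,dx<\infty$, where $\bar{K}(x)=\sup_{y\geqslant x}|K(y)|$. Let $$\widehat{\sigma}_n^2=\frac{1}{n}\sum_{s,t=1}^n K\Big(\frac{|s-t|}{m}\Big)X_sX_t,\qquad \sigma^2=\sum_{j=-\infty}^\infty\mathrm{Cov}(X_t,X_{t+j}).$$ If $\Phi_0,\Phi_1,\Phi_2$ are finite, then $\widehat{\sigma}_n^2\to\sigma^2$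 in mean square as $m,n\to\infty$ and $m=o(n)$.
   Context: Weakly stationary means that $\mathbb{E}X_t$ and $\mathrm{Cov}(X_t,X_{t+j})$ do not depend on $t$. Here $m>0$ is the bandwidth parameter of the estimator $\widehat{\sigma}_n^2$ (which depends on both $m$ and $n$), and convergence in mean square means $\mathbb{E}|\widehat{\sigma}_n^2-\sigma^2|^2\to 0$. *)

theory Defs
  imports "HOL-Probability.Probability" "HOL-Library.Landau_Symbols"
begin

definition covariance :: "'a measure \<Rightarrow> ('a \<Rightarrow> real) \<Rightarrow> ('a \<Rightarrow> real) \<Rightarrow> real" where
  "covariance M U V =
     (LINT \<omega>|M. (U \<omega> - (LINT \<omega>'|M. U \<omega>')) * (V \<omega> - (LINT \<omega>'|M. V \<omega>')))"

text \<open>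
  The first conjunct guarantees that the expectations and covariances in the others exist: a
  Bochner integral is 0 by convention when the integrand is not integrable.
\<close>

definition weakly_stationary :: "'a measure \<Rightarrow> (int \<Rightarrow> 'a \<Rightarrow> real) \<Rightarrow> bool" where
  "weakly_stationary M X \<longleftrightarrow>
     (\<forall>t. X t \<in> borel_measurable M \<and> integrable M (\<lambda>\<omega>. (X t \<omega>)\<^sup>2)) \<and>
     (\<forall>s t. (LINT \<omega>|M. X s \<omega>) = (LINT \<omega>|M. X t \<omega>)) \<and>
     (\<forall>s t j. covariance M (X s) (X (s + j)) = covariance M (X t) (X (t + j)))"

text \<open>
  The constants below are extended non-negative reals, so that finiteness is a meaningful
  assumption. Sequences indexed by $k \ge 1$ are functions on \<^typ>\<open>nat\<close> whose value at 0 is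
  never used; hence the shift by \<^const>\<open>Suc\<close>.
\<close>

definition Phi0 :: "'a measure \<Rightarrow> (int \<Rightarrow> 'a \<Rightarrow> real) \<Rightarrow> ennreal" where
  "Phi0 M X = (SUP t. \<integral>\<^sup>+\<omega>. ennreal (X t \<omega> ^ 4) \<partial>M)"

definition Phi1 :: "(nat \<Rightarrow> real) \<Rightarrow> ennreal" where
  "Phi1 \<phi> = (\<Sum>k. ennreal (real (Suc k) * \<phi> (Suc k)))"

definition Phi2 :: "(nat \<Rightarrow> real) \<Rightarrow> ennreal" where
  "Phi2 \<psi> = (\<Sum>k. ennreal (\<psi> (Suc k)))"

text \<open>
  A kernel on $[0,\infty)$ is represented by a function on all reals; only its values on
  $[0,\infty)$ matter. The supremum below is the true one when \<^term>\<open>K\<close> is bounded on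
  $[0,\infty)$.
\<close>

definition Kbar :: "(real \<Rightarrow> real) \<Rightarrow> real \<Rightarrow> real" where
  "Kbar K x = (SUP y\<in>{x..}. \<bar>K y\<bar>)"

definition sigma_hat_sq :: "(real \<Rightarrow> real) \<Rightarrow> (int \<Rightarrow> 'a \<Rightarrow> real) \<Rightarrow> real \<Rightarrow> nat \<Rightarrow> 'a \<Rightarrow> real" where
  "sigma_hat_sq K X m n \<omega> =
     1 / real n * (\<Sum>s = 1..int n. \<Sum>t = 1..int n. K (real_of_int \<bar>s - t\<bar> / m) * X s \<omega> * X t \<omega>)"

definition sigma_sq :: "'a measure \<Rightarrow> (int \<Rightarrow> 'a \<Rightarrow> real) \<Rightarrow> int \<Rightarrow> real" where
  "sigma_sq M X t = (\<Sum>\<^sub>\<infinity>j\<in>UNIV. covariance M (X t) (X (t + j)))"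

definition tendsto_in_mean_square ::
    "'a measure \<Rightarrow> ('i \<Rightarrow> 'a \<Rightarrow> real) \<Rightarrow> real \<Rightarrow> 'i filter \<Rightarrow> bool" where
  "tendsto_in_mean_square M Y c F \<longleftrightarrow>
     ((\<lambda>i. \<integral>\<^sup>+\<omega>. ennreal (\<bar>Y i \<omega> - c\<bar>\<^sup>2) \<partial>M) \<longlongrightarrow> 0) F"

end

theory Submission
  imports Defs
begin

text \<open>
  Write \<open>n * sigma_hat_sq = D + A\<close>, where \<open>D\<close> is the sum of the squares \<open>X s ^ 2\<close> and \<open>A\<close> collects
  the terms with \<open>s \<noteq> t\<close>. The mean square error is at most three times the sum of the squared bias
  and the variances of \<open>D / n\<close> and \<open>A / n\<close>.

  The expectation is the sum over \<open>j\<close> of \<open>K (\<bar>j\<bar> / m) (1 - \<bar>j\<bar> / n)\<^sup>+ \<gamma>(j)\<close>, with \<open>\<gamma>\<close> the summable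
  autocovariance. The weights are bounded and tend to 1, so that dominated convergence gives
  \<open>sigma_sq\<close> (\<open>weighted_mean_tendsto\<close>). The variance of \<open>D\<close> is \<open>O(n)\<close> by the bound on the covariances
  of squares. The heart of the matter is that the variance of \<open>A\<close> is \<open>O(n m)\<close>
  (\<open>quadratic_form_variance_le\<close>); the condition \<open>m = o(n)\<close> then finishes the proof.

  Expanding \<open>A\<^sup>2\<close> gives a sum over pairs of pairs \<open>(s, t)\<close>, \<open>(u, v)\<close>. When the four indices are
  distinct, consider the fourth cumulant. If the indices are sorted, then one of the three gaps is at
  least a third of the spread, and cutting the product at that gap shows that the cumulant is at most
  \<open>4 * \<phi> e\<close>, with \<open>e\<close> that third rounded up (\<open>cumulant_sorted_le\<close>). For given \<open>s\<close> there are \<open>O(d)\<close> pairs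
  \<open>(u, v)\<close> whose larger distance from \<open>s\<close> is \<open>d\<close>, so finiteness of the sum of \<open>k * \<phi> k\<close> bounds the sum
  over \<open>u, v\<close> of \<open>\<bar>Cov(X s X t, X u X v)\<bar>\<close>, taken over distinct indices, uniformly in \<open>s, t\<close>
  (\<open>cov4_sum_le\<close>). Schur's test turns this row bound into a multiple of the sum over \<open>s, t\<close> of
  \<open>K(\<bar>s - t\<bar> / m)\<^sup>2\<close>, which is \<open>O(n m)\<close> because \<open>K\<close> has a decreasing square-integrable majorant
  (\<open>kernel_weights_sum_le\<close>).

  Quadruples with a repeated index, such as \<open>X s ^ 2 * X t * X v\<close>, are not covered by the mixing bounds,
  and there are about \<open>n m\<^sup>2\<close> relevant ones, too many to be estimated one by one. Taken together, however,
  they form four times the sum over \<open>s\<close> of \<open>X s ^ 2 * Y s ^ 2\<close>, minus a non-negative term, where \<open>Y s\<close> is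
  the sum of the \<open>K(\<bar>s - t\<bar> / m) X t\<close> over \<open>t \<noteq> s\<close>. The fourth moment of \<open>Y s\<close> is \<open>O(m\<^sup>2)\<close>
  (\<open>linear_form_fourth_moment\<close>), so every summand has expectation \<open>O(m)\<close>. In the proof of this moment
  bound repeated indices would occur again; they are eliminated by the pointwise inequality
  \<open>quartic_le_distinct_sum\<close>, in which only products with four distinct factors and the square of
  \<open>\<Sum>x\<^sub>t\<^sup>2\<close> remain, and both have good expectations.
\<close>

section \<open>Quadratic forms without diagonal\<close>

lemma abs_mult_le_half_squares: "\<bar>x * y\<bar> \<le> (x\<^sup>2 + y\<^sup>2) / 2" for x y :: real
  using sum_squares_bound[of "\<bar>x\<bar>" "\<bar>y\<bar>"] by (simp add: abs_mult)

text \<open>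
  Schur's test for symmetric matrices: \<open>2 \<bar>a i * a j\<bar> \<le> (a i)\<^sup>2 + (a j)\<^sup>2\<close>, and by symmetry both
  squares contribute the same amount, which the row sums control.
\<close>

lemma schur_test:
  fixes a :: "'b \<Rightarrow> real" and c :: "'b \<Rightarrow> 'b \<Rightarrow> real"
  assumes sym: "\<And>i j. i \<in> J \<Longrightarrow> j \<in> J \<Longrightarrow> c i j = c j i"
    and row: "\<And>i. i \<in> J \<Longrightarrow> (\<Sum>j\<in>J. \<bar>c i j\<bar>) \<le> C"
  shows "(\<Sum>i\<in>J. \<Sum>j\<in>J. \<bar>a i * a j * c i j\<bar>) \<le> C * (\<Sum>i\<in>J. (a i)\<^sup>2)"
proof -
  have pt: "\<bar>a i * a j * c i j\<bar> \<le> ((a i)\<^sup>2 * \<bar>c i j\<bar> + (a j)\<^sup>2 * \<bar>c i j\<bar>) / 2" for i j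
  proof -
    have "\<bar>a i * a j\<bar> * \<bar>c i j\<bar> \<le> ((a i)\<^sup>2 + (a j)\<^sup>2) / 2 * \<bar>c i j\<bar>"
      by (intro mult_right_mono abs_mult_le_half_squares) simp
    then show ?thesis by (simp add: abs_mult algebra_simps add_divide_distrib)
  qed
  have swap: "(\<Sum>i\<in>J. \<Sum>j\<in>J. (a j)\<^sup>2 * \<bar>c i j\<bar>) = (\<Sum>i\<in>J. \<Sum>j\<in>J. (a i)\<^sup>2 * \<bar>c i j\<bar>)"
    by (subst sum.swap) (intro sum.cong refl, use sym in auto)
  have "(\<Sum>i\<in>J. \<Sum>j\<in>J. \<bar>a i * a j * c i j\<bar>)
      \<le> (\<Sum>i\<in>J. \<Sum>j\<in>J. ((a i)\<^sup>2 * \<bar>c i j\<bar> + (a j)\<^sup>2 * \<bar>c i j\<bar>) / 2)"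
    by (intro sum_mono pt)
  also have "\<dots> = (\<Sum>i\<in>J. (a i)\<^sup>2 * (\<Sum>j\<in>J. \<bar>c i j\<bar>))"
    unfolding sum_divide_distrib[symmetric] sum.distrib swap sum_distrib_left by simp
  also have "\<dots> \<le> (\<Sum>i\<in>J. (a i)\<^sup>2 * C)"
    by (intro sum_mono mult_left_mono row) auto
  also have "\<dots> = C * (\<Sum>i\<in>J. (a i)\<^sup>2)"
    by (simp add: sum_distrib_left mult.commute)
  finally show ?thesis .
qed

definition distinct_sum :: "'b set \<Rightarrow> ('b \<Rightarrow> 'b \<Rightarrow> 'b \<Rightarrow> 'b \<Rightarrow> real) \<Rightarrow> real" where
  "distinct_sum I f = (\<Sum>s\<in>I. \<Sum>t\<in>I. \<Sum>u\<in>I. \<Sum>v\<in>I. if distinct [s, t, u, v] then f s t u v else 0)"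

lemma distinct_sum_cong:
  assumes "\<And>s t u v. s \<in> I \<Longrightarrow> t \<in> I \<Longrightarrow> u \<in> I \<Longrightarrow> v \<in> I \<Longrightarrow> distinct [s, t, u, v] \<Longrightarrow> f s t u v = g s t u v"
  shows "distinct_sum I f = distinct_sum I g"
  unfolding distinct_sum_def using assms by (intro sum.cong refl) auto

lemma distinct_sum_add:
  "distinct_sum I (\<lambda>s t u v. f s t u v + g s t u v) = distinct_sum I f + distinct_sum I g"
  unfolding distinct_sum_def sum.distrib[symmetric] by (intro sum.cong refl) auto

text \<open>
  Pairs \<open>(s, t)\<close> and \<open>(u, v)\<close> that meet do so in one of the four ways \<open>u = s\<close>, \<open>u = t\<close>, \<open>v = s\<close>, \<open>v = t\<close>; by
  symmetry each contributes the sum of the squared row sums. The two ways of meeting twice have then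
  been counted once too often.
\<close>

lemma offdiagonal_square:
  fixes b :: "'b \<Rightarrow> 'b \<Rightarrow> real"
  assumes fin: "finite I"
    and sym: "\<And>s t. s \<in> I \<Longrightarrow> t \<in> I \<Longrightarrow> b s t = b t s"
    and diag: "\<And>s. s \<in> I \<Longrightarrow> b s s = 0"
  shows "(\<Sum>s\<in>I. \<Sum>t\<in>I. b s t)\<^sup>2 =
     distinct_sum I (\<lambda>s t u v. b s t * b u v)
     + 4 * (\<Sum>s\<in>I. (\<Sum>t\<in>I. b s t)\<^sup>2) - 2 * (\<Sum>s\<in>I. \<Sum>t\<in>I. (b s t)\<^sup>2)"
proof -
  let ?S = "\<lambda>f. (\<Sum>s\<in>I. \<Sum>t\<in>I. \<Sum>u\<in>I. \<Sum>v\<in>I. f s t u v :: real)"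
  have sq: "(\<Sum>s\<in>I. \<Sum>t\<in>I. b s t)\<^sup>2 = ?S (\<lambda>s t u v. b s t * b u v)"
    unfolding power2_eq_square sum_distrib_right unfolding sum_distrib_left by (rule refl)
  \<comment> \<open>Inclusion and exclusion over the coincidences; if \<open>s = t\<close> or \<open>u = v\<close>, both sides vanish.\<close>
  have pt: "b s t * b u v = (if distinct [s, t, u, v] then b s t * b u v else 0)
      + (if u = s then b s t * b u v else 0) + (if u = t then b s t * b u v else 0)
      + (if v = s then b s t * b u v else 0) + (if v = t then b s t * b u v else 0)
      - (if u = s then if v = t then b s t * b u v else 0 else 0)
      - (if u = t then if v = s then b s t * b u v else 0 else 0)"
    if "s \<in> I" "t \<in> I" "u \<in> I" "v \<in> I" for s t u v
    using diag[OF that(1)] diag[OF that(3)]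
    by (cases "s = t"; cases "u = v"; cases "u = s"; cases "u = t"; cases "v = s"; cases "v = t") simp_all
  have exp: "?S (\<lambda>s t u v. b s t * b u v)
      = ?S (\<lambda>s t u v. if distinct [s, t, u, v] then b s t * b u v else 0)
      + ?S (\<lambda>s t u v. if u = s then b s t * b u v else 0)
      + ?S (\<lambda>s t u v. if u = t then b s t * b u v else 0)
      + ?S (\<lambda>s t u v. if v = s then b s t * b u v else 0)
      + ?S (\<lambda>s t u v. if v = t then b s t * b u v else 0)
      - ?S (\<lambda>s t u v. if u = s then if v = t then b s t * b u v else 0 else 0)
      - ?S (\<lambda>s t u v. if u = t then if v = s then b s t * b u v else 0 else 0)"
    unfolding sum.distrib[symmetric] sum_subtractf[symmetric]
    by (intro sum.cong refl pt)
  have row: "(\<Sum>s\<in>I. (\<Sum>t\<in>I. b s t)\<^sup>2) = (\<Sum>s\<in>I. \<Sum>t\<in>I. \<Sum>v\<in>I. b s t * b s v)"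
    by (simp add: power2_eq_square sum_product)
  have row': "(\<Sum>s\<in>I. \<Sum>t\<in>I. \<Sum>v\<in>I. b s t * b t v) = (\<Sum>s\<in>I. (\<Sum>t\<in>I. b s t)\<^sup>2)"
    unfolding row by (subst sum.swap) (intro sum.cong refl, use sym in auto)
  have pull: "(\<Sum>v\<in>I. if P then f v else 0) = (if P then \<Sum>v\<in>I. f v else 0)" for P and f :: "'b \<Rightarrow> real"
    by simp
  have e1: "?S (\<lambda>s t u v. if u = s then b s t * b u v else 0) = (\<Sum>s\<in>I. (\<Sum>t\<in>I. b s t)\<^sup>2)"
    unfolding row pull using fin by (simp add: sum.delta)
  have e2: "?S (\<lambda>s t u v. if u = t then b s t * b u v else 0) = (\<Sum>s\<in>I. (\<Sum>t\<in>I. b s t)\<^sup>2)"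
    unfolding row'[symmetric] pull using fin by (simp add: sum.delta)
  have e3: "?S (\<lambda>s t u v. if v = s then b s t * b u v else 0) = (\<Sum>s\<in>I. (\<Sum>t\<in>I. b s t)\<^sup>2)"
    unfolding row using fin by (auto simp: sum.delta sym intro!: sum.cong)
  have e4: "?S (\<lambda>s t u v. if v = t then b s t * b u v else 0) = (\<Sum>s\<in>I. (\<Sum>t\<in>I. b s t)\<^sup>2)"
    unfolding row'[symmetric] using fin by (auto simp: sum.delta sym intro!: sum.cong)
  have e5: "?S (\<lambda>s t u v. if u = s then if v = t then b s t * b u v else 0 else 0)
      = (\<Sum>s\<in>I. \<Sum>t\<in>I. (b s t)\<^sup>2)"
    unfolding pull using fin by (simp add: sum.delta power2_eq_square)
  have e6: "?S (\<lambda>s t u v. if u = t then if v = s then b s t * b u v else 0 else 0)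
      = (\<Sum>s\<in>I. \<Sum>t\<in>I. (b s t)\<^sup>2)"
    unfolding pull using fin by (auto simp: sum.delta power2_eq_square sym intro!: sum.cong)
  show ?thesis
    unfolding sq exp e1 e2 e3 e4 e5 e6 distinct_sum_def by simp
qed

text \<open>
  Repeated indices in the expansion of a fourth power cost only the square of the sum of squares, at
  the price of constants. This allows moments of linear forms to be bounded from information on
  products with four distinct factors alone.
\<close>

lemma quartic_le_distinct_sum:
  fixes x :: "'b \<Rightarrow> real"
  assumes fin: "finite I"
  shows "(\<Sum>t\<in>I. x t) ^ 4 \<le> 4 * distinct_sum I (\<lambda>s t u v. x s * x t * x u * x v)
     + 292 * (\<Sum>t\<in>I. (x t)\<^sup>2)\<^sup>2"
proof -
  define Y where "Y = (\<Sum>t\<in>I. x t)"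
  define p where "p = (\<Sum>t\<in>I. (x t)\<^sup>2)"
  define D where "D = distinct_sum I (\<lambda>s t u v. x s * x t * x u * x v)"
  define b where "b s t = (if s = t then 0 else x s * x t)" for s t
  define R where "R = (\<Sum>s\<in>I. \<Sum>t\<in>I. b s t)"
  have p0: "0 \<le> p" unfolding p_def by (intro sum_nonneg) auto
  have rowb: "(\<Sum>t\<in>I. b s t) = x s * (Y - x s)" if "s \<in> I" for s
  proof -
    have "(\<Sum>t\<in>I. b s t) = (\<Sum>t\<in>I. x s * x t - (if s = t then x s * x t else 0))"
      unfolding b_def by (intro sum.cong) auto
    also have "\<dots> = x s * Y - x s * x s"
      unfolding Y_def using fin that by (simp add: sum_subtractf sum_distrib_left)
    finally show ?thesis by (simp add: algebra_simps)
  qed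
  have R: "R = Y\<^sup>2 - p"
  proof -
    have "R = (\<Sum>s\<in>I. x s * Y - (x s)\<^sup>2)"
      unfolding R_def by (intro sum.cong refl) (simp add: rowb algebra_simps power2_eq_square)
    then show ?thesis
      by (simp add: sum_subtractf sum_distrib_right[symmetric] Y_def[symmetric] p_def power2_eq_square)
  qed
  have "R\<^sup>2 = distinct_sum I (\<lambda>s t u v. b s t * b u v)
     + 4 * (\<Sum>s\<in>I. (\<Sum>t\<in>I. b s t)\<^sup>2) - 2 * (\<Sum>s\<in>I. \<Sum>t\<in>I. (b s t)\<^sup>2)"
    unfolding R_def by (rule offdiagonal_square[OF fin]) (auto simp: b_def)
  moreover have "distinct_sum I (\<lambda>s t u v. b s t * b u v) = D"
    unfolding D_def by (rule distinct_sum_cong) (auto simp: b_def)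
  moreover have "(\<Sum>s\<in>I. \<Sum>t\<in>I. (b s t)\<^sup>2) \<ge> 0" by (intro sum_nonneg) auto
  moreover have "(\<Sum>s\<in>I. (\<Sum>t\<in>I. b s t)\<^sup>2) \<le> 2 * p * Y\<^sup>2 + 2 * p\<^sup>2"
  proof -
    have le: "(x s)\<^sup>2 \<le> p" if "s \<in> I" for s
      unfolding p_def using fin that by (intro member_le_sum) auto
    have "(\<Sum>s\<in>I. (\<Sum>t\<in>I. b s t)\<^sup>2) \<le> (\<Sum>s\<in>I. (x s)\<^sup>2 * (2 * Y\<^sup>2 + 2 * p))"
    proof (rule sum_mono)
      fix s assume s: "s \<in> I"
      have "(Y - x s)\<^sup>2 \<le> 2 * Y\<^sup>2 + 2 * (x s)\<^sup>2"
        using zero_le_power2[of "Y + x s"] by (simp add: power2_eq_square algebra_simps)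
      also have "\<dots> \<le> 2 * Y\<^sup>2 + 2 * p" using le[OF s] by simp
      finally show "(\<Sum>t\<in>I. b s t)\<^sup>2 \<le> (x s)\<^sup>2 * (2 * Y\<^sup>2 + 2 * p)"
        unfolding rowb[OF s] power_mult_distrib by (intro mult_left_mono) auto
    qed
    also have "\<dots> = p * (2 * Y\<^sup>2 + 2 * p)" by (simp add: p_def sum_distrib_right)
    finally show ?thesis by (simp add: algebra_simps power2_eq_square)
  qed
  ultimately have R2: "R\<^sup>2 \<le> D + 8 * (p * Y\<^sup>2) + 8 * p\<^sup>2" by (simp add: algebra_simps)
  have "Y ^ 4 = (R + p)\<^sup>2" unfolding R by (simp add: power_mult[symmetric])
  also have "\<dots> \<le> 2 * R\<^sup>2 + 2 * p\<^sup>2"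
    using zero_le_power2[of "R - p"] by (simp add: power2_eq_square algebra_simps)
  also have "\<dots> \<le> 2 * D + 16 * (p * Y\<^sup>2) + 18 * p\<^sup>2" using R2 by simp
  \<comment> \<open>Half of \<open>Y ^ 4\<close> is absorbed into the left-hand side; the final constant is \<open>2 * (128 + 18)\<close>.\<close>
  also have "16 * (p * Y\<^sup>2) \<le> 128 * p\<^sup>2 + Y ^ 4 / 2"
  proof -
    have "0 \<le> (16 * p - Y\<^sup>2)\<^sup>2" by simp
    then show ?thesis by (simp add: power2_diff power_mult_distrib power_mult[symmetric])
  qed
  finally show ?thesis unfolding Y_def[symmetric] p_def[symmetric] D_def[symmetric] by simp
qed

section \<open>Sums over distances of integers\<close>

text \<open>
  Every positive distance from \<open>s\<close> is attained at most twice.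
\<close>

lemma sum_nat_dist_le:
  fixes g :: "nat \<Rightarrow> real" and I :: "int set"
  assumes fin: "finite I" and g0: "\<And>d. 1 \<le> d \<Longrightarrow> 0 \<le> g d"
    and B: "\<And>N. (\<Sum>d=1..N. g d) \<le> B"
  shows "(\<Sum>t\<in>I - {s}. g (nat \<bar>s - t\<bar>)) \<le> 2 * B"
proof -
  define N where "N = Max ((\<lambda>t. nat \<bar>s - t\<bar>) ` I)"
  have N: "nat \<bar>s - t\<bar> \<le> N" if "t \<in> I" for t
    unfolding N_def using fin that by (intro Max_ge) auto
  have half: "(\<Sum>t\<in>T. g (nat \<bar>s - t\<bar>)) \<le> B"
    if T: "T \<subseteq> I - {s}" and inj: "inj_on (\<lambda>t. nat \<bar>s - t\<bar>) T" for T
  proof -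
    have "(\<Sum>t\<in>T. g (nat \<bar>s - t\<bar>)) = (\<Sum>d\<in>(\<lambda>t. nat \<bar>s - t\<bar>) ` T. g d)"
      using sum.reindex[OF inj, of g] by simp
    also have "\<dots> \<le> (\<Sum>d=1..N. g d)"
      using T N by (intro sum_mono2) (auto intro!: g0)
    also have "\<dots> \<le> B" by (rule B)
    finally show ?thesis .
  qed
  have split: "I - {s} = {t\<in>I. t < s} \<union> {t\<in>I. s < t}" by auto
  have "(\<Sum>t\<in>I - {s}. g (nat \<bar>s - t\<bar>))
     = (\<Sum>t\<in>{t\<in>I. t < s}. g (nat \<bar>s - t\<bar>)) + (\<Sum>t\<in>{t\<in>I. s < t}. g (nat \<bar>s - t\<bar>))"
    unfolding split using fin by (intro sum.union_disjoint) auto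
  also have "\<dots> \<le> B + B"
    by (intro add_mono half) (auto simp: inj_on_def)
  finally show ?thesis by simp
qed

text \<open>
  In the square of side \<open>2 d + 1\<close> around \<open>(s, s)\<close>, the boundary, where the maximum equals \<open>d\<close>, has \<open>8 d\<close>
  points. The proof bounds \<open>h (max p q)\<close> by \<open>h p\<close> on \<open>q \<le> p\<close> plus \<open>h q\<close> on \<open>p \<le> q\<close>.
\<close>

lemma sum_max_dist_le:
  fixes h :: "nat \<Rightarrow> real" and I :: "int set"
  assumes fin: "finite I" and h0: "\<And>d. 1 \<le> d \<Longrightarrow> 0 \<le> h d"
    and B: "\<And>N. (\<Sum>d=1..N. real d * h d) \<le> B"
  shows "(\<Sum>u\<in>I - {s}. \<Sum>v\<in>I - {s}. h (max (nat \<bar>s - u\<bar>) (nat \<bar>s - v\<bar>))) \<le> 8 * B"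
proof -
  let ?d = "\<lambda>u. nat \<bar>s - u\<bar>"
  let ?g = "\<lambda>u v. if ?d v \<le> ?d u then h (?d u) else 0"
  have pt: "h (max (?d u) (?d v)) \<le> ?g u v + ?g v u" if "u \<in> I - {s}" "v \<in> I - {s}" for u v
    using that h0[of "?d u"] h0[of "?d v"] by (auto simp: max_def)
  have count: "(\<Sum>v\<in>I - {s}. ?g u v) \<le> 2 * (real (?d u) * h (?d u))" if u: "u \<in> I - {s}" for u
  proof -
    have "(\<Sum>v\<in>I - {s}. ?g u v) = (\<Sum>v\<in>I - {s}. (if ?d v \<le> ?d u then 1 else 0) * h (?d u))"
      by (intro sum.cong) auto
    also have "\<dots> = (\<Sum>v\<in>I - {s}. if ?d v \<le> ?d u then 1 else 0) * h (?d u)"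
      by (rule sum_distrib_right[symmetric])
    also have "\<dots> \<le> (2 * real (?d u)) * h (?d u)"
    proof (rule mult_right_mono)
      show "(\<Sum>v\<in>I - {s}. if ?d v \<le> ?d u then 1 else 0) \<le> 2 * real (?d u)"
      proof (rule sum_nat_dist_le[OF fin, of "\<lambda>e. if e \<le> ?d u then 1 else 0"])
        fix N
        have "(\<Sum>e = 1..N. if e \<le> ?d u then 1 else 0 :: real) = real (card ({1..N} \<inter> {e. e \<le> ?d u}))"
          by (simp add: sum.If_cases)
        also have "\<dots> \<le> real (card {1..?d u})"
          by (intro of_nat_mono card_mono) auto
        finally show "(\<Sum>e = 1..N. if e \<le> ?d u then 1 else 0) \<le> real (?d u)" by simp
      qed auto
    qed (use u h0[of "?d u"] in auto)
    finally show ?thesis by simp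
  qed
  have "(\<Sum>u\<in>I - {s}. \<Sum>v\<in>I - {s}. h (max (?d u) (?d v)))
     \<le> (\<Sum>u\<in>I - {s}. \<Sum>v\<in>I - {s}. ?g u v + ?g v u)"
    by (intro sum_mono pt)
  also have "\<dots> = (\<Sum>u\<in>I - {s}. \<Sum>v\<in>I - {s}. ?g u v) + (\<Sum>u\<in>I - {s}. \<Sum>v\<in>I - {s}. ?g v u)"
    by (simp only: sum.distrib)
  also have "(\<Sum>u\<in>I - {s}. \<Sum>v\<in>I - {s}. ?g v u) = (\<Sum>u\<in>I - {s}. \<Sum>v\<in>I - {s}. ?g u v)"
    by (rule sum.swap)
  also have "(\<Sum>u\<in>I - {s}. \<Sum>v\<in>I - {s}. ?g u v) + (\<Sum>u\<in>I - {s}. \<Sum>v\<in>I - {s}. ?g u v)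
     \<le> 2 * (\<Sum>u\<in>I - {s}. 2 * (real (?d u) * h (?d u)))"
    using sum_mono[of "I - {s}" "\<lambda>u. \<Sum>v\<in>I - {s}. ?g u v" "\<lambda>u. 2 * (real (?d u) * h (?d u))", OF count]
    unfolding mult_2[of "sum _ _"] by (intro add_mono)
  also have "\<dots> = 4 * (\<Sum>u\<in>I - {s}. real (?d u) * h (?d u))"
    by (simp add: sum_distrib_left)
  also have "\<dots> \<le> 4 * (2 * B)"
    by (intro mult_left_mono sum_nat_dist_le[OF fin, of "\<lambda>d. real d * h d"] B mult_nonneg_nonneg h0) auto
  finally show ?thesis by simp
qed

text \<open>
  The three values \<open>3 k - 2, 3 k - 1, 3 k\<close> of \<open>d\<close> share the term \<open>\<phi> k\<close>, and each of them is at most \<open>3 k\<close>.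
\<close>

lemma sum_dilate_third_le:
  fixes \<phi> :: "nat \<Rightarrow> real"
  assumes nonneg: "\<And>k. 1 \<le> k \<Longrightarrow> 0 \<le> \<phi> k"
    and P: "\<And>N. (\<Sum>k=1..N. real k * \<phi> k) \<le> P"
  shows "(\<Sum>d=1..N. real d * \<phi> ((d + 2) div 3)) \<le> 9 * P"
proof -
  have blocks: "(\<Sum>d=1..3*N. real d * \<phi> ((d + 2) div 3)) \<le> 9 * (\<Sum>k=1..N. real k * \<phi> k)" for N
  proof (induction N)
    case (Suc N)
    have "{1..3 * Suc N} = insert (3*N+3) (insert (3*N+2) (insert (3*N+1) {1..3*N}))" by auto
    moreover have "(3*N+3+2) div 3 = Suc N" "(3*N+2+2) div 3 = Suc N" "(3*N+1+2) div 3 = Suc N" by simp_all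
    ultimately have "(\<Sum>d=1..3*Suc N. real d * \<phi> ((d + 2) div 3))
       = (real (3*N+3) + real (3*N+2) + real (3*N+1)) * \<phi> (Suc N) + (\<Sum>d=1..3*N. real d * \<phi> ((d + 2) div 3))"
      by (simp add: algebra_simps)
    also have "\<dots> \<le> 9 * (real (Suc N) * \<phi> (Suc N)) + 9 * (\<Sum>k=1..N. real k * \<phi> k)"
      using Suc nonneg[of "Suc N"] by (intro add_mono) (auto simp: algebra_simps)
    finally show ?case by simp
  qed simp
  have "(\<Sum>d=1..N. real d * \<phi> ((d + 2) div 3)) \<le> (\<Sum>d=1..3*N. real d * \<phi> ((d + 2) div 3))"
    by (intro sum_mono2) (auto intro!: mult_nonneg_nonneg nonneg)
  also have "\<dots> \<le> 9 * P" using blocks[of N] P[of N] by linarith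
  finally show ?thesis .
qed

text \<open>
  A distance \<open>d > 0\<close> occurs \<open>2 (n - d)\<close> times in the square.
\<close>

lemma sum_square_abs_diff:
  fixes g :: "nat \<Rightarrow> real"
  shows "(\<Sum>s = 1..int n. \<Sum>t = 1..int n. g (nat \<bar>s - t\<bar>))
     = real n * g 0 + 2 * (\<Sum>d=1..n. (real n - real d) * g d)"
proof (induction n)
  case (Suc n)
  have I: "{1..int (Suc n)} = insert (int n + 1) {1..int n}" by auto
  have notin: "int n + 1 \<notin> {1..int n}" by simp
  have rev: "(\<Sum>t = 1..int n. g (nat \<bar>int n + 1 - t\<bar>)) = (\<Sum>d=1..n. g d)"
    by (rule sum.reindex_bij_witness[of _ "\<lambda>d. int n + 1 - int d" "\<lambda>t. nat (int n + 1 - t)"]) auto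
  have rev': "(\<Sum>t = 1..int n. g (nat \<bar>t - (int n + 1)\<bar>)) = (\<Sum>d=1..n. g d)"
    using rev by (simp add: abs_minus_commute)
  have "(\<Sum>s = 1..int (Suc n). \<Sum>t = 1..int (Suc n). g (nat \<bar>s - t\<bar>))
     = g 0 + 2 * (\<Sum>d=1..n. g d) + (\<Sum>s = 1..int n. \<Sum>t = 1..int n. g (nat \<bar>s - t\<bar>))"
    unfolding I sum.insert[OF finite_atLeastAtMost_int notin] sum.distrib rev rev' by simp
  also have "\<dots> = real (Suc n) * g 0 + 2 * (\<Sum>d=1..n. (real (Suc n) - real d) * g d)"
    unfolding Suc by (simp add: algebra_simps sum.distrib sum_subtractf)
  finally show ?case by simp
qed simp

section \<open>Sums of squared kernel weights\<close>

text \<open>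
  The value at the right end point of each of the intervals of length \<open>1 / m\<close> is the least one there,
  so the step function with these values lies below \<open>f\<close>.
\<close>

lemma sum_antimono_le_nn_integral:
  fixes f :: "real \<Rightarrow> real"
  assumes anti: "antimono_on {0..} f" and m: "0 < m"
  shows "(\<Sum>d=1..N. ennreal (f (real d / m))) \<le> ennreal m * (\<integral>\<^sup>+x\<in>{0..}. ennreal (f x) \<partial>lborel)"
proof -
  let ?A = "\<lambda>d::nat. {(real d - 1) / m <.. real d / m}"
  have disj: "disjoint_family_on ?A {1..N}"
  proof -
    have "?A d \<inter> ?A e = {}" if "d < e" for d e :: nat
    proof -
      have "real d / m \<le> (real e - 1) / m"
        using that m by (intro divide_right_mono) auto
      then show ?thesis by auto
    qed
    then show ?thesis
      unfolding disjoint_family_on_def by (metis Int_commute linorder_neqE_nat)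
  qed
  have pt: "(\<Sum>d=1..N. ennreal (f (real d / m)) * indicator (?A d) x)
      \<le> ennreal (f x) * indicator {0..} x" for x
  proof -
    have pos: "0 \<le> x" if "x \<in> ?A d" "1 \<le> d" for d
    proof -
      have "0 \<le> (real d - 1) / m" using that m by simp
      with that show ?thesis by simp
    qed
    have "(\<Sum>d=1..N. ennreal (f (real d / m)) * indicator (?A d) x)
        \<le> (\<Sum>d=1..N. ennreal (f x) * indicator (?A d) x)"
    proof (intro sum_mono)
      fix d assume d: "d \<in> {1..N}"
      show "ennreal (f (real d / m)) * indicator (?A d) x \<le> ennreal (f x) * indicator (?A d) x"
      proof (cases "x \<in> ?A d")
        case True
        then have "f (real d / m) \<le> f x"
          using pos[OF True] d m by (intro monotone_onD[OF anti]) auto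
        then show ?thesis by (auto intro!: mult_right_mono ennreal_leI)
      qed simp
    qed
    also have "\<dots> = ennreal (f x) * indicator (\<Union>d\<in>{1..N}. ?A d) x"
      by (subst indicator_UN_disjoint[OF _ disj]) (auto simp: sum_distrib_left)
    also have "\<dots> \<le> ennreal (f x) * indicator {0..} x"
      using pos by (intro mult_left_mono) (auto split: split_indicator)
    finally show ?thesis .
  qed
  have "(\<Sum>d=1..N. ennreal (f (real d / m)) * ennreal (1 / m))
      = (\<Sum>d=1..N. \<integral>\<^sup>+x. ennreal (f (real d / m)) * indicator (?A d) x \<partial>lborel)"
  proof (intro sum.cong refl)
    fix d
    have "emeasure lborel (?A d) = ennreal (1 / m)"
      using m by (subst emeasure_lborel_Ioc) (auto simp: divide_right_mono diff_divide_distrib)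
    then show "ennreal (f (real d / m)) * ennreal (1 / m)
        = (\<integral>\<^sup>+x. ennreal (f (real d / m)) * indicator (?A d) x \<partial>lborel)"
      by (subst nn_integral_cmult_indicator) auto
  qed
  also have "\<dots> = (\<integral>\<^sup>+x. (\<Sum>d=1..N. ennreal (f (real d / m)) * indicator (?A d) x) \<partial>lborel)"
    by (rule nn_integral_sum[symmetric]) auto
  also have "\<dots> \<le> (\<integral>\<^sup>+x\<in>{0..}. ennreal (f x) \<partial>lborel)"
    by (intro nn_integral_mono pt)
  finally have le: "ennreal m * (\<Sum>d=1..N. ennreal (f (real d / m)) * ennreal (1 / m))
      \<le> ennreal m * (\<integral>\<^sup>+x\<in>{0..}. ennreal (f x) \<partial>lborel)"
    by (intro mult_left_mono) auto
  have "ennreal m * ennreal (1 / m) = 1"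
    using m by (simp add: ennreal_mult[symmetric])
  then have "ennreal m * (\<Sum>d=1..N. ennreal (f (real d / m)) * ennreal (1 / m))
      = (\<Sum>d=1..N. ennreal (f (real d / m)))"
    unfolding sum_distrib_right[symmetric]
    by (subst mult.left_commute) (erule ssubst, rule mult.right_neutral)
  with le show ?thesis by simp
qed

lemma abs_le_Kbar:
  assumes "bdd_above ((\<lambda>x. \<bar>K x\<bar>) ` {0..})" "0 \<le> x" "x \<le> y"
  shows "\<bar>K y\<bar> \<le> Kbar K x"
  unfolding Kbar_def using assms
  by (intro cSUP_upper bdd_above_mono[OF assms(1)]) auto

lemma Kbar_antimono:
  assumes "bdd_above ((\<lambda>x. \<bar>K x\<bar>) ` {0..})" "0 \<le> x" "x \<le> y"
  shows "Kbar K y \<le> Kbar K x"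
  unfolding Kbar_def using assms
  by (intro cSUP_subset_mono bdd_above_mono[OF assms(1)]) auto

text \<open>
  The number of effectively nonzero weights in a row of the estimator is of order \<open>m\<close>. The square of
  \<open>K\<close> itself may be badly behaved at the grid points \<open>d / m\<close>; passing to the monotone majorant makes the
  comparison with the integral possible.
\<close>

lemma kernel_weights_sum_le:
  fixes K :: "real \<Rightarrow> real" and I :: "int set"
  assumes bdd: "bdd_above ((\<lambda>x. \<bar>K x\<bar>) ` {0..})"
    and L2: "(\<integral>\<^sup>+x\<in>{0..}. ennreal ((Kbar K x)\<^sup>2) \<partial>lborel) < \<infinity>"
    and m: "1 \<le> m" and fin: "finite I"
  shows "(\<Sum>t\<in>I. (K (real_of_int \<bar>s - t\<bar> / m))\<^sup>2)
     \<le> ((Kbar K 0)\<^sup>2 + 2 * enn2real (\<integral>\<^sup>+x\<in>{0..}. ennreal ((Kbar K x)\<^sup>2) \<partial>lborel)) * m"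
proof -
  define J where "J = enn2real (\<integral>\<^sup>+x\<in>{0..}. ennreal ((Kbar K x)\<^sup>2) \<partial>lborel)"
  have J: "ennreal J = (\<integral>\<^sup>+x\<in>{0..}. ennreal ((Kbar K x)\<^sup>2) \<partial>lborel)" "0 \<le> J"
    unfolding J_def using L2 by auto
  have nonneg: "0 \<le> Kbar K x" if "0 \<le> x" for x
    using abs_le_Kbar[OF bdd that order_refl] by linarith
  have anti: "antimono_on {0..} (\<lambda>x. (Kbar K x)\<^sup>2)"
    by (intro monotone_onI power_mono Kbar_antimono[OF bdd] nonneg) auto
  have part: "(\<Sum>d=1..N. (Kbar K (real d / m))\<^sup>2) \<le> m * J" for N
  proof -
    have "ennreal (\<Sum>d=1..N. (Kbar K (real d / m))\<^sup>2) = (\<Sum>d=1..N. ennreal ((Kbar K (real d / m))\<^sup>2))"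
      by (rule sum_ennreal[symmetric]) simp
    also have "\<dots> \<le> ennreal m * ennreal J"
      unfolding J(1) using m by (intro sum_antimono_le_nn_integral anti) auto
    also have "\<dots> = ennreal (m * J)" using m J(2) by (simp add: ennreal_mult)
    finally show ?thesis using m J(2) by (simp add: ennreal_le_iff)
  qed
  have "(\<Sum>t\<in>I. (K (real_of_int \<bar>s - t\<bar> / m))\<^sup>2) \<le> (\<Sum>t\<in>insert s I. (K (real_of_int \<bar>s - t\<bar> / m))\<^sup>2)"
    using fin by (intro sum_mono2) auto
  also have "\<dots> = (K 0)\<^sup>2 + (\<Sum>t\<in>I - {s}. (K (real_of_int \<bar>s - t\<bar> / m))\<^sup>2)"
    using fin by (simp add: sum.insert_remove)
  also have "\<dots> \<le> (Kbar K 0)\<^sup>2 + (\<Sum>t\<in>I - {s}. (Kbar K (real (nat \<bar>s - t\<bar>) / m))\<^sup>2)"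
  proof (intro add_mono sum_mono)
    have le: "(K x)\<^sup>2 \<le> (Kbar K x)\<^sup>2" if "0 \<le> x" for x
      using power_mono[OF abs_le_Kbar[OF bdd that order_refl], of 2] by simp
    show "(K 0)\<^sup>2 \<le> (Kbar K 0)\<^sup>2" by (rule le) simp
    show "(K (real_of_int \<bar>s - t\<bar> / m))\<^sup>2 \<le> (Kbar K (real (nat \<bar>s - t\<bar>) / m))\<^sup>2" for t
      using le[of "real_of_int \<bar>s - t\<bar> / m"] m by simp
  qed
  also have "(\<Sum>t\<in>I - {s}. (Kbar K (real (nat \<bar>s - t\<bar>) / m))\<^sup>2) \<le> 2 * (m * J)"
    by (rule sum_nat_dist_le[OF fin, of "\<lambda>d. (Kbar K (real d / m))\<^sup>2"]) (simp, rule part)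
  also have "(Kbar K 0)\<^sup>2 + 2 * (m * J) \<le> ((Kbar K 0)\<^sup>2 + 2 * J) * m"
    using mult_left_mono[OF m, of "(Kbar K 0)\<^sup>2"] by (simp add: algebra_simps)
  finally show ?thesis unfolding J_def by simp
qed

section \<open>Convergence of the expectation\<close>

lemma has_sum_int_even:
  fixes g :: "nat \<Rightarrow> real"
  assumes "summable (\<lambda>k. \<bar>g k\<bar>)"
  shows "((\<lambda>j. g (nat \<bar>j\<bar>)) has_sum (g 0 + 2 * (\<Sum>k. g (Suc k)))) (UNIV :: int set)"
proof -
  have S0: "summable (\<lambda>k. norm (g (Suc k)))"
    using assms by (simp add: summable_Suc_iff[of "\<lambda>k. \<bar>g k\<bar>"])
  have S: "((\<lambda>k. g (Suc k)) has_sum (\<Sum>k. g (Suc k))) UNIV"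
    by (rule norm_summable_imp_has_sum[OF S0 summable_sums[OF summable_norm_cancel[OF S0]]])
  have [simp]: "nat (1 + int k) = Suc k" "nat (int k + 1) = Suc k" for k by linarith+
  let ?pos = "\<lambda>k. int (Suc k)" and ?neg = "\<lambda>k. - int (Suc k)"
  have pos: "((\<lambda>j. g (nat \<bar>j\<bar>)) has_sum (\<Sum>k. g (Suc k))) (range ?pos)"
    by (subst has_sum_reindex) (use S in \<open>auto simp: inj_on_def o_def\<close>)
  have neg: "((\<lambda>j. g (nat \<bar>j\<bar>)) has_sum (\<Sum>k. g (Suc k))) (range ?neg)"
    by (subst has_sum_reindex) (use S in \<open>auto simp: inj_on_def o_def\<close>)
  have zero: "((\<lambda>j. g (nat \<bar>j\<bar>)) has_sum g 0) {0::int}"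
    by (rule has_sum_finiteI) auto
  have "((\<lambda>j. g (nat \<bar>j\<bar>)) has_sum (g 0 + ((\<Sum>k. g (Suc k)) + (\<Sum>k. g (Suc k)))))
     ({0} \<union> (range ?pos \<union> range ?neg))"
    by (intro has_sum_Un_disjoint zero pos neg) auto
  moreover have "{0} \<union> (range ?pos \<union> range ?neg) = UNIV"
  proof -
    have "j \<in> {0} \<union> (range ?pos \<union> range ?neg)" for j
    proof (rule linorder_cases[of j 0])
      assume "0 < j"
      then have "j = ?pos (nat (j - 1))" by simp
      then have "j \<in> range ?pos" by (rule range_eqI)
      then show ?thesis by blast
    next
      assume "j < 0"
      then have "j = ?neg (nat (- j - 1))" by simp
      then have "j \<in> range ?neg" by (rule range_eqI)
      then show ?thesis by blast
    qed simp
    then show ?thesis by blast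
  qed
  ultimately show ?thesis by simp
qed

text \<open>
  Grouping by the distance \<open>d = \<bar>s - t\<bar>\<close> gives \<open>r d\<close> the weight \<open>(1 - d / n) * K (d / m)\<close>, twice if
  \<open>d > 0\<close>. These weights are bounded and tend to 1 for fixed \<open>d\<close>, so Tannery's theorem applies.
\<close>

lemma weighted_mean_tendsto:
  fixes K :: "real \<Rightarrow> real" and r :: "nat \<Rightarrow> real" and m :: "'i \<Rightarrow> real" and n :: "'i \<Rightarrow> nat"
  assumes K0: "K 0 = 1" and cont: "continuous (at 0 within {0..}) K"
    and bdd: "bdd_above ((\<lambda>x. \<bar>K x\<bar>) ` {0..})"
    and sm: "summable (\<lambda>k. \<bar>r k\<bar>)"
    and mpos: "\<And>i. 0 < m i" and m: "filterlim m at_top F" and n: "filterlim n at_top F"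
  shows "((\<lambda>i. 1 / real (n i) * (\<Sum>s = 1..int (n i). \<Sum>t = 1..int (n i).
            K (real_of_int \<bar>s - t\<bar> / m i) * r (nat \<bar>s - t\<bar>)))
     \<longlongrightarrow> r 0 + 2 * (\<Sum>k. r (Suc k))) F"
\<comment> \<open>Tannery's theorem needs a proper filter; along \<open>bot\<close> every function converges to everything.\<close>
proof (cases "F = bot")
  case False
  obtain B where B: "\<And>x. 0 \<le> x \<Longrightarrow> \<bar>K x\<bar> \<le> B"
    using bdd by (auto simp: bdd_above_def)
  define a where "a k i = (if Suc k \<le> n i
     then (1 - real (Suc k) / real (n i)) * (K (real (Suc k) / m i) * r (Suc k)) else 0)" for k i
  have npos: "\<forall>\<^sub>F i in F. 0 < n i"
    using n[unfolded filterlim_at_top, rule_format, of 1] by eventually_elim simp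
  have nreal: "filterlim (\<lambda>i. real (n i)) at_top F"
    by (rule filterlim_compose[OF filterlim_real_sequentially n])
  have lim: "((\<lambda>i. a k i) \<longlongrightarrow> r (Suc k)) F" for k
  proof -
    have "((\<lambda>i. real (Suc k) / m i) \<longlongrightarrow> 0) F"
      by (intro tendsto_divide_0[OF tendsto_const] filterlim_at_top_imp_at_infinity m)
    then have "((\<lambda>i. K (real (Suc k) / m i)) \<longlongrightarrow> K 0) F"
      by (rule continuous_within_tendsto_compose[OF cont, rotated])
         (auto intro!: always_eventually divide_nonneg_pos mpos)
    moreover have "((\<lambda>i. 1 - real (Suc k) / real (n i)) \<longlongrightarrow> 1 - 0) F"
      by (intro tendsto_diff tendsto_const tendsto_divide_0[OF tendsto_const]
          filterlim_at_top_imp_at_infinity nreal)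
    ultimately have "((\<lambda>i. (1 - real (Suc k) / real (n i)) * (K (real (Suc k) / m i) * r (Suc k)))
        \<longlongrightarrow> (1 - 0) * (K 0 * r (Suc k))) F"
      by (intro tendsto_mult tendsto_const)
    moreover have "\<forall>\<^sub>F i in F. Suc k \<le> n i"
      using n by (simp add: filterlim_at_top)
    then have "\<forall>\<^sub>F i in F. (1 - real (Suc k) / real (n i)) * (K (real (Suc k) / m i) * r (Suc k)) = a k i"
      by eventually_elim (simp add: a_def)
    ultimately show ?thesis using K0 by (auto elim: Lim_transform_eventually)
  qed
  have bound: "norm (a k i) \<le> B * \<bar>r (Suc k)\<bar>" for k i
  proof (cases "Suc k \<le> n i")
    case True
    then have "\<bar>1 - real (Suc k) / real (n i)\<bar> \<le> 1" by (auto simp: field_simps)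
    moreover have "\<bar>K (real (Suc k) / m i)\<bar> \<le> B" using mpos[of i] by (intro B) auto
    ultimately have "\<bar>1 - real (Suc k) / real (n i)\<bar> * (\<bar>K (real (Suc k) / m i)\<bar> * \<bar>r (Suc k)\<bar>)
        \<le> 1 * (B * \<bar>r (Suc k)\<bar>)"
      by (intro mult_mono) auto
    then show ?thesis using True by (simp add: a_def abs_mult)
  next
    case False
    then show ?thesis using B[of 0] by (simp add: a_def)
  qed
  have "((\<lambda>i. \<Sum>k. a k i) \<longlongrightarrow> (\<Sum>k. r (Suc k))) F"
  proof -
    have "summable (\<lambda>k. B * \<bar>r (Suc k)\<bar>)"
      using sm by (intro summable_mult) (simp add: summable_Suc_iff[of "\<lambda>k. \<bar>r k\<bar>"])
    then show ?thesis
      using tannerys_theorem[where M = "\<lambda>k. B * \<bar>r (Suc k)\<bar>", OF lim _ _ False] bound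
      by (simp add: case_prod_unfold)
  qed
  then have "((\<lambda>i. r 0 + 2 * (\<Sum>k. a k i)) \<longlongrightarrow> r 0 + 2 * (\<Sum>k. r (Suc k))) F"
    by (intro tendsto_intros)
  moreover have "\<forall>\<^sub>F i in F. r 0 + 2 * (\<Sum>k. a k i) = 1 / real (n i) *
      (\<Sum>s = 1..int (n i). \<Sum>t = 1..int (n i). K (real_of_int \<bar>s - t\<bar> / m i) * r (nat \<bar>s - t\<bar>))"
    using npos
  proof eventually_elim
    case (elim i)
    let ?g = "\<lambda>d. K (real d / m i) * r d"
    have "(\<Sum>k. a k i) = (\<Sum>k<n i. a k i)"
      by (rule suminf_finite) (auto simp: a_def)
    also have "\<dots> = (\<Sum>k<n i. (1 - real (Suc k) / real (n i)) * ?g (Suc k))"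
      by (intro sum.cong refl) (auto simp: a_def)
    also have "\<dots> = (\<Sum>d=1..n i. (1 - real d / real (n i)) * ?g d)"
      by (rule sum.reindex_bij_witness[of _ "\<lambda>d. d - 1" Suc]) auto
    also have "\<dots> = 1 / real (n i) * (\<Sum>d=1..n i. (real (n i) - real d) * ?g d)"
      unfolding sum_distrib_left using elim by (intro sum.cong refl) (simp add: field_simps)
    finally have *: "(\<Sum>k. a k i) = 1 / real (n i) * (\<Sum>d=1..n i. (real (n i) - real d) * ?g d)" .
    have "(\<Sum>s = 1..int (n i). \<Sum>t = 1..int (n i). K (real_of_int \<bar>s - t\<bar> / m i) * r (nat \<bar>s - t\<bar>))
       = real (n i) * ?g 0 + 2 * (\<Sum>d=1..n i. (real (n i) - real d) * ?g d)"
      using sum_square_abs_diff[of ?g "n i"] by simp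
    then show ?case
      unfolding * using elim K0 by (simp add: field_simps)
  qed
  ultimately show ?thesis by (rule Lim_transform_eventually)
qed simp

section \<open>Products of variables with finite fourth moments\<close>

text \<open>
  A crude form of the inequality of arithmetic and geometric means: the constant 1 in place of 1/4.
\<close>

lemma abs_mult4_le_powers: "\<bar>a * b * c * d\<bar> \<le> a ^ 4 + b ^ 4 + c ^ 4 + d ^ 4" for a b c d :: real
proof -
  have "\<bar>(a * b) * (c * d)\<bar> \<le> ((a * b)\<^sup>2 + (c * d)\<^sup>2) / 2" by (rule abs_mult_le_half_squares)
  moreover have "\<bar>a\<^sup>2 * b\<^sup>2\<bar> \<le> (a ^ 4 + b ^ 4) / 2" "\<bar>c\<^sup>2 * d\<^sup>2\<bar> \<le> (c ^ 4 + d ^ 4) / 2"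
    using abs_mult_le_half_squares[of "a\<^sup>2" "b\<^sup>2"] abs_mult_le_half_squares[of "c\<^sup>2" "d\<^sup>2"]
    by (simp_all add: power_mult[symmetric])
  moreover have "0 \<le> a ^ 4" "0 \<le> b ^ 4" "0 \<le> c ^ 4" "0 \<le> d ^ 4" by simp_all
  ultimately show ?thesis by (simp add: power_mult_distrib mult.assoc)
qed

lemma integrable_mult4:
  fixes f1 f2 f3 f4 :: "'a \<Rightarrow> real"
  assumes [measurable]: "f1 \<in> borel_measurable M" "f2 \<in> borel_measurable M"
    "f3 \<in> borel_measurable M" "f4 \<in> borel_measurable M"
    and int: "integrable M (\<lambda>\<omega>. f1 \<omega> ^ 4)" "integrable M (\<lambda>\<omega>. f2 \<omega> ^ 4)"
    "integrable M (\<lambda>\<omega>. f3 \<omega> ^ 4)" "integrable M (\<lambda>\<omega>. f4 \<omega> ^ 4)"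
  shows "integrable M (\<lambda>\<omega>. f1 \<omega> * f2 \<omega> * f3 \<omega> * f4 \<omega>)"
proof (rule Bochner_Integration.integrable_bound)
  show "integrable M (\<lambda>\<omega>. f1 \<omega> ^ 4 + f2 \<omega> ^ 4 + f3 \<omega> ^ 4 + f4 \<omega> ^ 4)"
    by (intro Bochner_Integration.integrable_add int)
  show "AE \<omega> in M. norm (f1 \<omega> * f2 \<omega> * f3 \<omega> * f4 \<omega>)
      \<le> norm (f1 \<omega> ^ 4 + f2 \<omega> ^ 4 + f3 \<omega> ^ 4 + f4 \<omega> ^ 4)"
    using abs_mult4_le_powers by (intro AE_I2) (metis abs_ge_self order_trans real_norm_def)
qed simp

lemma integral_distinct_sum:
  assumes "\<And>s t u v. integrable M (f s t u v)"
  shows "integrable M (\<lambda>\<omega>. distinct_sum I (\<lambda>s t u v. f s t u v \<omega>))"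
    and "(LINT \<omega>|M. distinct_sum I (\<lambda>s t u v. f s t u v \<omega>))
       = distinct_sum I (\<lambda>s t u v. LINT \<omega>|M. f s t u v \<omega>)"
proof -
  have int: "integrable M (\<lambda>\<omega>. if P then f s t u v \<omega> else 0)" for P s t u v
    using assms by (cases P) auto
  have val: "(LINT \<omega>|M. (if P then f s t u v \<omega> else 0)) = (if P then (LINT \<omega>|M. f s t u v \<omega>) else 0)" for P s t u v
    by (cases P) auto
  show "integrable M (\<lambda>\<omega>. distinct_sum I (\<lambda>s t u v. f s t u v \<omega>))"
    unfolding distinct_sum_def by (intro Bochner_Integration.integrable_sum int)
  show "(LINT \<omega>|M. distinct_sum I (\<lambda>s t u v. f s t u v \<omega>))
       = distinct_sum I (\<lambda>s t u v. LINT \<omega>|M. f s t u v \<omega>)"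
    unfolding distinct_sum_def
    by (simp only: Bochner_Integration.integral_sum Bochner_Integration.integrable_sum int val)
qed

lemma (in prob_space) covariance_eq:
  assumes "integrable M U" "integrable M V" "integrable M (\<lambda>\<omega>. U \<omega> * V \<omega>)"
  shows "covariance M U V = expectation (\<lambda>\<omega>. U \<omega> * V \<omega>) - expectation U * expectation V"
proof -
  let ?u = "expectation U" and ?v = "expectation V"
  have "(\<lambda>\<omega>. (U \<omega> - ?u) * (V \<omega> - ?v)) = (\<lambda>\<omega>. U \<omega> * V \<omega> - ?v * U \<omega> - ?u * V \<omega> + ?u * ?v)"
    by (auto simp: algebra_simps)
  then have "covariance M U V = expectation (\<lambda>\<omega>. U \<omega> * V \<omega> - ?v * U \<omega> - ?u * V \<omega> + ?u * ?v)"
    unfolding covariance_def by simp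
  also have "\<dots> = expectation (\<lambda>\<omega>. U \<omega> * V \<omega>) - ?v * ?u - ?u * ?v + ?u * ?v"
    using assms by (simp add: prob_space)
  finally show ?thesis by simp
qed

text \<open>
  The quantitative content of the assumptions: \<open>Q\<close> bounds the fourth moments, \<open>P\<close> and \<open>R\<close> bound the
  partial sums of \<open>k * \<phi> k\<close> and \<open>\<psi> k\<close>. Stationarity comes in later, when the limit of the expectation
  is identified.
\<close>

locale weakly_dependent_process = prob_space M
  for M :: "'a measure" +
  fixes X :: "int \<Rightarrow> 'a \<Rightarrow> real" and \<phi> \<psi> :: "nat \<Rightarrow> real" and Q P R :: real
  assumes X_measurable [measurable]: "\<And>t. X t \<in> borel_measurable M"
    and integrable_X4: "\<And>t. integrable M (\<lambda>\<omega>. X t \<omega> ^ 4)"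
    and expectation_X4_le: "\<And>t. expectation (\<lambda>\<omega>. X t \<omega> ^ 4) \<le> Q"
    and centred: "\<And>t. expectation (X t) = 0"
    and expectation_X2_le: "\<And>t. expectation (\<lambda>\<omega>. (X t \<omega>)\<^sup>2) \<le> 1"
    and phi_nonneg: "\<And>k. 1 \<le> k \<Longrightarrow> 0 \<le> \<phi> k"
    and phi_antimono: "antimono_on {1..} \<phi>"
    and cov_first: "\<And>i j k l. i < j \<Longrightarrow> j < k \<Longrightarrow> k < l \<Longrightarrow>
           \<bar>covariance M (X i) (\<lambda>\<omega>. X j \<omega> * X k \<omega> * X l \<omega>)\<bar> \<le> \<phi> (nat (j - i))"
    and cov_last: "\<And>i j k l. i < j \<Longrightarrow> j < k \<Longrightarrow> k < l \<Longrightarrow>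
           \<bar>covariance M (\<lambda>\<omega>. X i \<omega> * X j \<omega> * X k \<omega>) (X l)\<bar> \<le> \<phi> (nat (l - k))"
    and cov_middle: "\<And>i j k l. i < j \<Longrightarrow> j < k \<Longrightarrow> k < l \<Longrightarrow>
           \<bar>covariance M (\<lambda>\<omega>. X i \<omega> * X j \<omega>) (\<lambda>\<omega>. X k \<omega> * X l \<omega>)\<bar> \<le> \<phi> (nat (k - j))"
    and cov_pair: "\<And>i j. i < j \<Longrightarrow> \<bar>covariance M (X i) (X j)\<bar> \<le> \<phi> (nat (j - i))"
    and phi_sum_le: "\<And>N. (\<Sum>k=1..N. real k * \<phi> k) \<le> P"
    and psi_nonneg: "\<And>k. 1 \<le> k \<Longrightarrow> 0 \<le> \<psi> k"
    and cov_squares: "\<And>i j. i < j \<Longrightarrow>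
           covariance M (\<lambda>\<omega>. (X i \<omega>)\<^sup>2) (\<lambda>\<omega>. (X j \<omega>)\<^sup>2) \<le> \<psi> (nat (j - i))"
    and psi_sum_le: "\<And>N. (\<Sum>k=1..N. \<psi> k) \<le> R"
begin

definition \<gamma> :: "int \<Rightarrow> int \<Rightarrow> real" where
  "\<gamma> s t = expectation (\<lambda>\<omega>. X s \<omega> * X t \<omega>)"

definition \<mu> :: "int \<Rightarrow> int \<Rightarrow> int \<Rightarrow> int \<Rightarrow> real" where
  "\<mu> s t u v = expectation (\<lambda>\<omega>. X s \<omega> * X t \<omega> * X u \<omega> * X v \<omega>)"

definition cumulant :: "int \<Rightarrow> int \<Rightarrow> int \<Rightarrow> int \<Rightarrow> real" where
  "cumulant s t u v = \<mu> s t u v - \<gamma> s t * \<gamma> u v - \<gamma> s u * \<gamma> t v - \<gamma> s v * \<gamma> t u"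

lemma Q_nonneg: "0 \<le> Q"
  by (rule order_trans[OF _ expectation_X4_le[of 0]]) (simp add: Bochner_Integration.integral_nonneg)

lemma P_nonneg: "0 \<le> P"
  using phi_sum_le[of 0] by simp

lemma integrable_X_mult4: "integrable M (\<lambda>\<omega>. X s \<omega> * X t \<omega> * X u \<omega> * X v \<omega>)"
  by (intro integrable_mult4 integrable_X4) simp_all

lemma integrable_X_mult3: "integrable M (\<lambda>\<omega>. X s \<omega> * X t \<omega> * X u \<omega>)"
  using integrable_mult4[of "X s" M "X t" "X u" "\<lambda>_. 1"] by (simp add: integrable_X4)

lemma integrable_X_mult2: "integrable M (\<lambda>\<omega>. X s \<omega> * X t \<omega>)"
  using integrable_mult4[of "X s" M "X t" "\<lambda>_. 1" "\<lambda>_. 1"] by (simp add: integrable_X4)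

lemma integrable_X: "integrable M (X s)"
  using integrable_mult4[of "X s" M "\<lambda>_. 1" "\<lambda>_. 1" "\<lambda>_. 1"] by (simp add: integrable_X4)

lemma integrable_X_square: "integrable M (\<lambda>\<omega>. (X s \<omega>)\<^sup>2)"
  using integrable_X_mult2[of s s] by (simp add: power2_eq_square)

lemma gamma_commute: "\<gamma> s t = \<gamma> t s"
  unfolding \<gamma>_def by (simp add: mult.commute)

lemma mu_swap: "\<mu> t s u v = \<mu> s t u v" "\<mu> s u t v = \<mu> s t u v" "\<mu> s t v u = \<mu> s t u v"
  unfolding \<mu>_def by (simp_all add: mult_ac)

lemma cumulant_swap:
  "cumulant t s u v = cumulant s t u v" "cumulant s u t v = cumulant s t u v"
  "cumulant s t v u = cumulant s t u v"
  unfolding cumulant_def mu_swap[of t s u v] mu_swap(2)[of s u t v] mu_swap(3)[of s t v u]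
  by (simp_all add: gamma_commute[of t s] gamma_commute[of u t] gamma_commute[of v u])

lemma cov_eq_gamma: "covariance M (X i) (X j) = \<gamma> i j"
  using covariance_eq[OF integrable_X integrable_X integrable_X_mult2] by (simp add: centred \<gamma>_def)

lemma mu_first:
  assumes "i < j" "j < k" "k < l"
  shows "\<bar>\<mu> i j k l\<bar> \<le> \<phi> (nat (j - i))"
proof -
  have "integrable M (\<lambda>\<omega>. X i \<omega> * (X j \<omega> * X k \<omega> * X l \<omega>))"
    using integrable_X_mult4[of i j k l] by (simp add: mult.assoc)
  then show ?thesis
    using cov_first[OF assms] covariance_eq[OF integrable_X[of i] integrable_X_mult3[of j k l]]
    by (simp add: centred \<mu>_def mult.assoc)
qed

lemma mu_last:
  assumes "i < j" "j < k" "k < l"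
  shows "\<bar>\<mu> i j k l\<bar> \<le> \<phi> (nat (l - k))"
  using cov_last[OF assms] covariance_eq[OF integrable_X_mult3 integrable_X integrable_X_mult4, of i j k l]
  by (simp add: centred \<mu>_def)

lemma mu_middle:
  assumes "i < j" "j < k" "k < l"
  shows "\<bar>\<mu> i j k l - \<gamma> i j * \<gamma> k l\<bar> \<le> \<phi> (nat (k - j))"
proof -
  have "integrable M (\<lambda>\<omega>. (X i \<omega> * X j \<omega>) * (X k \<omega> * X l \<omega>))"
    using integrable_X_mult4[of i j k l] by (simp add: mult.assoc)
  then show ?thesis
    using cov_middle[OF assms] covariance_eq[OF integrable_X_mult2[of i j] integrable_X_mult2[of k l]]
    by (simp add: \<mu>_def \<gamma>_def mult.assoc)
qed

lemma gamma_le_phi: "i \<noteq> j \<Longrightarrow> \<bar>\<gamma> i j\<bar> \<le> \<phi> (nat \<bar>i - j\<bar>)"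
  using cov_pair[of i j] cov_pair[of j i] by (cases "i < j") (simp_all add: cov_eq_gamma gamma_commute[of j i])

lemma gamma_le_1: "\<bar>\<gamma> s t\<bar> \<le> 1"
proof -
  have "\<bar>\<gamma> s t\<bar> \<le> expectation (\<lambda>\<omega>. \<bar>X s \<omega> * X t \<omega>\<bar>)"
    unfolding \<gamma>_def by (rule integral_abs_bound)
  also have "\<dots> \<le> expectation (\<lambda>\<omega>. ((X s \<omega>)\<^sup>2 + (X t \<omega>)\<^sup>2) / 2)"
    by (intro integral_mono integrable_abs integrable_X_mult2 abs_mult_le_half_squares)
       (auto intro!: integrable_X_square)
  also have "\<dots> \<le> 1"
    using expectation_X2_le[of s] expectation_X2_le[of t] by (simp add: integrable_X_square)
  finally show ?thesis .
qed

text \<open>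
  One factor is estimated by mixing, the other one by the normalisation of the second moments.
\<close>

lemma gamma_mult_le_phi:
  assumes "i < j"
  shows "\<bar>\<gamma> i j * \<gamma> k l\<bar> \<le> \<phi> (nat (j - i))" "\<bar>\<gamma> k l * \<gamma> i j\<bar> \<le> \<phi> (nat (j - i))"
proof -
  have "\<bar>\<gamma> i j\<bar> * \<bar>\<gamma> k l\<bar> \<le> \<phi> (nat (j - i)) * 1"
    using gamma_le_phi[of i j] assms phi_nonneg[of "nat (j - i)"]
    by (intro mult_mono gamma_le_1) (auto simp: abs_minus_commute)
  then show "\<bar>\<gamma> i j * \<gamma> k l\<bar> \<le> \<phi> (nat (j - i))" "\<bar>\<gamma> k l * \<gamma> i j\<bar> \<le> \<phi> (nat (j - i))"
    by (simp_all add: abs_mult mult.commute)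
qed

lemma phi_mono: "1 \<le> e \<Longrightarrow> e \<le> d \<Longrightarrow> \<phi> d \<le> \<phi> e"
  using monotone_onD[OF phi_antimono, of e d] by simp

text \<open>
  One of the gaps \<open>j - i\<close>, \<open>k - j\<close>, \<open>l - k\<close> is at least \<open>e\<close>, a third of the spread rounded up. Whichever it
  is, the matching covariance bound controls \<open>\<mu> i j k l - \<gamma> i j * \<gamma> k l\<close>. The other two products of
  covariances involve a pair of indices that straddles every gap or at least the largest one.
\<close>

lemma cumulant_sorted_le:
  assumes ord: "i < j" "j < k" "k < l"
  shows "\<bar>cumulant i j k l\<bar> \<le> 4 * \<phi> ((nat (l - i) + 2) div 3)"
proof -
  define e where "e = (nat (l - i) + 2) div 3"
  have e1: "1 \<le> e" using ord unfolding e_def by simp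
  have e3: "3 * e \<le> nat (l - i) + 2" unfolding e_def by simp
  have le: "\<phi> (nat d) \<le> \<phi> e" if "int e \<le> d" for d
    using that e1 by (intro phi_mono) auto
  have outer: "\<bar>\<gamma> i l * \<gamma> j k\<bar> \<le> \<phi> e"
    using gamma_mult_le_phi(1)[of i l j k] le[of "l - i"] e3 ord by fastforce
  have cross: "\<bar>\<gamma> i k * \<gamma> j l\<bar> \<le> \<phi> e"
  proof (cases "int e \<le> k - i")
    case True
    then show ?thesis using gamma_mult_le_phi(1)[of i k j l] le[of "k - i"] ord by simp
  next
    case False
    then have "int e \<le> l - j" using e3 ord by linarith
    then show ?thesis using gamma_mult_le_phi(2)[of j l i k] le[of "l - j"] ord by simp
  qed
  have main: "\<bar>\<mu> i j k l - \<gamma> i j * \<gamma> k l\<bar> \<le> 2 * \<phi> e"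
  proof -
    consider "int e \<le> j - i" | "int e \<le> k - j" | "int e \<le> l - k"
      using e3 ord by linarith
    then show ?thesis
    proof cases
      case 1
      then show ?thesis
        using mu_first[OF ord] gamma_mult_le_phi(1)[of i j k l] le[of "j - i"] ord by linarith
    next
      case 2
      then show ?thesis using mu_middle[OF ord] le[of "k - j"] phi_nonneg[OF e1] by linarith
    next
      case 3
      then show ?thesis
        using mu_last[OF ord] gamma_mult_le_phi(2)[of k l i j] le[of "l - k"] ord by linarith
    qed
  qed
  show ?thesis
    using outer cross main unfolding cumulant_def e_def[symmetric] by linarith
qed

text \<open>
  Both sides are symmetric in the four indices, so that it suffices to sort them. This is why the
  cumulant is used here, and not a covariance of two products.
\<close>

lemma cumulant_le_spread:
  assumes "distinct [s, t, u, v]"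
  shows "\<bar>cumulant s t u v\<bar>
    \<le> 4 * \<phi> ((nat (max (max s t) (max u v) - min (min s t) (min u v)) + 2) div 3)"
proof -
  define B where "B s t u v \<longleftrightarrow> \<bar>cumulant s t u v\<bar>
    \<le> 4 * \<phi> ((nat (max (max s t) (max u v) - min (min s t) (min u v)) + 2) div 3)" for s t u v
  have swap: "B t s u v = B s t u v" "B s u t v = B s t u v" "B s t v u = B s t u v" for s t u v
    unfolding B_def cumulant_swap(1)[of t s] cumulant_swap(2)[of s u t] cumulant_swap(3)[of s t v u]
    by (simp_all add: max.commute max.left_commute max.assoc min.commute min.left_commute min.assoc)
  have sorted: "B i j k l" if "i < j" "j < k" "k < l" for i j k l
  proof -
    have "max (max i j) (max k l) = l" "min (min i j) (min k l) = i"
      using that by auto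
    with cumulant_sorted_le[OF that] show ?thesis unfolding B_def by simp
  qed
  \<comment> \<open>Sorting by insertion: the last index first, then the third one, then the first two.\<close>
  have three: "B i j k l" if "i < j" "j < k" "l \<noteq> i" "l \<noteq> j" "l \<noteq> k" for i j k l
    using that sorted swap by (metis linorder_neqE)
  have two: "B i j k l" if "i < j" "distinct [i, j, k, l]" for i j k l
    using that three swap by (metis linorder_neqE distinct_length_2_or_more)
  have "B s t u v"
    using assms two swap by (metis linorder_neqE distinct_length_2_or_more)
  then show ?thesis unfolding B_def .
qed

text \<open>
  A weaker bound than the one by the spread: it forgets \<open>t\<close>, which makes the number of pairs \<open>(u, v)\<close>
  at a given distance easy to count.
\<close>

lemma cumulant_le:
  assumes "distinct [s, t, u, v]"
  shows "\<bar>cumulant s t u v\<bar> \<le> 4 * \<phi> ((max (nat \<bar>s - u\<bar>) (nat \<bar>s - v\<bar>) + 2) div 3)"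
proof -
  have "\<phi> ((nat (max (max s t) (max u v) - min (min s t) (min u v)) + 2) div 3)
     \<le> \<phi> ((max (nat \<bar>s - u\<bar>) (nat \<bar>s - v\<bar>) + 2) div 3)"
  proof (intro phi_mono div_le_mono add_right_mono)
    have "1 \<le> nat \<bar>s - u\<bar>" using assms by (simp add: Suc_le_eq)
    then have "3 \<le> max (nat \<bar>s - u\<bar>) (nat \<bar>s - v\<bar>) + 2" by linarith
    then show "1 \<le> (max (nat \<bar>s - u\<bar>) (nat \<bar>s - v\<bar>) + 2) div 3"
      using div_le_mono[of 3 _ 3] by fastforce
    show "max (nat \<bar>s - u\<bar>) (nat \<bar>s - v\<bar>) \<le> nat (max (max s t) (max u v) - min (min s t) (min u v))"
      by (auto simp: max_def min_def)
  qed
  then show ?thesis using cumulant_le_spread[OF assms] by linarith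
qed

section \<open>Summability of the covariances of products\<close>

text \<open>
  A bound for the sum of the absolute autocovariances.
\<close>

definition \<Gamma> :: real where "\<Gamma> = 1 + 2 * P"

lemma Gamma_pos: "0 < \<Gamma>"
  unfolding \<Gamma>_def using P_nonneg by simp

lemma gamma_sum_le:
  assumes "finite I"
  shows "(\<Sum>t\<in>I. \<bar>\<gamma> s t\<bar>) \<le> \<Gamma>"
proof -
  have "(\<Sum>t\<in>I. \<bar>\<gamma> s t\<bar>) \<le> (\<Sum>t\<in>insert s I. \<bar>\<gamma> s t\<bar>)"
    using assms by (intro sum_mono2) auto
  also have "\<dots> = \<bar>\<gamma> s s\<bar> + (\<Sum>t\<in>I - {s}. \<bar>\<gamma> s t\<bar>)"
    using assms by (simp add: sum.insert_remove)
  also have "\<dots> \<le> 1 + (\<Sum>t\<in>I - {s}. \<phi> (nat \<bar>s - t\<bar>))"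
    by (intro add_mono gamma_le_1 sum_mono gamma_le_phi) auto
  also have "(\<Sum>t\<in>I - {s}. \<phi> (nat \<bar>s - t\<bar>)) \<le> 2 * P"
  proof (rule sum_nat_dist_le[OF assms phi_nonneg])
    show "(\<Sum>d=1..N. \<phi> d) \<le> P" for N
    proof -
      have "(\<Sum>d=1..N. \<phi> d) \<le> (\<Sum>d=1..N. real d * \<phi> d)"
        using mult_right_mono[OF _ phi_nonneg, of 1 "real _"] by (intro sum_mono) auto
      with phi_sum_le[of N] show ?thesis by linarith
    qed
  qed simp
  finally show ?thesis unfolding \<Gamma>_def by simp
qed

definition cov4 :: "int \<Rightarrow> int \<Rightarrow> int \<Rightarrow> int \<Rightarrow> real" where
  "cov4 s t u v = (if distinct [s, t, u, v] then \<mu> s t u v - \<gamma> s t * \<gamma> u v else 0)"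

text \<open>
  The factor 288 is \<open>4 * 8 * 9\<close>, from \<open>cumulant_le\<close>, \<open>sum_max_dist_le\<close> and \<open>sum_dilate_third_le\<close>.
\<close>

definition cov4_const :: real where "cov4_const = 2 * \<Gamma>\<^sup>2 + 288 * P"

lemma cov4_const_nonneg: "0 \<le> cov4_const"
  unfolding cov4_const_def using P_nonneg by simp

text \<open>
  The covariance of \<open>X s * X t\<close> and \<open>X u * X v\<close> is the cumulant plus two products of covariances. Each of
  these products has one factor depending on \<open>u\<close> and one depending on \<open>v\<close>, hence is summable, and the
  cumulants are summable because only \<open>O(d)\<close> pairs \<open>(u, v)\<close> lie at distance \<open>d\<close> from \<open>s\<close>.
\<close>

lemma cov4_sum_le:
  assumes fin: "finite I"
  shows "(\<Sum>u\<in>I. \<Sum>v\<in>I. \<bar>cov4 s t u v\<bar>) \<le> cov4_const"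
proof -
  let ?J = "I - {s}"
  let ?h = "\<lambda>d. \<phi> ((d + 2) div 3)"
  let ?m = "\<lambda>u v. max (nat \<bar>s - u\<bar>) (nat \<bar>s - v\<bar>)"
  have finJ: "finite ?J" using fin by simp
  have h0: "0 \<le> ?h d" if "1 \<le> d" for d
    using that by (intro phi_nonneg) (use div_le_mono[of 3 "d + 2" 3] in auto)
  have pt: "\<bar>cov4 s t u v\<bar> \<le> \<bar>\<gamma> s u\<bar> * \<bar>\<gamma> t v\<bar> + \<bar>\<gamma> s v\<bar> * \<bar>\<gamma> t u\<bar> + 4 * ?h (?m u v)"
    if uv: "u \<in> ?J" "v \<in> ?J" for u v
  proof (cases "distinct [s, t, u, v]")
    case True
    have "cov4 s t u v = cumulant s t u v + \<gamma> s u * \<gamma> t v + \<gamma> s v * \<gamma> t u"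
      using True unfolding cov4_def cumulant_def by simp
    then show ?thesis
      using cumulant_le[OF True] unfolding abs_mult[symmetric] by linarith
  next
    case False
    have "1 \<le> ?m u v" using uv by (auto simp: max_def)
    then have "0 \<le> ?h (?m u v)" by (rule h0)
    moreover have "cov4 s t u v = 0" using False unfolding cov4_def by (rule if_not_P)
    ultimately show ?thesis by simp
  qed
  have prod: "(\<Sum>u\<in>?J. \<Sum>v\<in>?J. \<bar>\<gamma> a u\<bar> * \<bar>\<gamma> b v\<bar>) \<le> \<Gamma>\<^sup>2" for a b
    unfolding power2_eq_square sum_product[symmetric]
    using gamma_sum_le[OF finJ] Gamma_pos by (intro mult_mono) (auto intro: sum_nonneg)
  have "(\<Sum>u\<in>I. \<Sum>v\<in>I. \<bar>cov4 s t u v\<bar>) = (\<Sum>u\<in>?J. \<Sum>v\<in>?J. \<bar>cov4 s t u v\<bar>)"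
  proof -
    have "(\<Sum>v\<in>I. \<bar>cov4 s t u v\<bar>) = (\<Sum>v\<in>?J. \<bar>cov4 s t u v\<bar>)" for u
      using fin by (intro sum.mono_neutral_right) (auto simp: cov4_def)
    moreover have "(\<Sum>u\<in>I. \<Sum>v\<in>?J. \<bar>cov4 s t u v\<bar>) = (\<Sum>u\<in>?J. \<Sum>v\<in>?J. \<bar>cov4 s t u v\<bar>)"
      using fin by (intro sum.mono_neutral_right) (auto simp: cov4_def)
    ultimately show ?thesis by simp
  qed
  also have "\<dots> \<le> (\<Sum>u\<in>?J. \<Sum>v\<in>?J. \<bar>\<gamma> s u\<bar> * \<bar>\<gamma> t v\<bar> + \<bar>\<gamma> s v\<bar> * \<bar>\<gamma> t u\<bar> + 4 * ?h (?m u v))"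
    by (intro sum_mono pt)
  also have "\<dots> = (\<Sum>u\<in>?J. \<Sum>v\<in>?J. \<bar>\<gamma> s u\<bar> * \<bar>\<gamma> t v\<bar>) + (\<Sum>u\<in>?J. \<Sum>v\<in>?J. \<bar>\<gamma> s v\<bar> * \<bar>\<gamma> t u\<bar>)
      + 4 * (\<Sum>u\<in>?J. \<Sum>v\<in>?J. ?h (?m u v))"
    by (simp add: sum.distrib sum_distrib_left)
  also have "(\<Sum>u\<in>?J. \<Sum>v\<in>?J. \<bar>\<gamma> s v\<bar> * \<bar>\<gamma> t u\<bar>) = (\<Sum>u\<in>?J. \<Sum>v\<in>?J. \<bar>\<gamma> s u\<bar> * \<bar>\<gamma> t v\<bar>)"
    by (rule sum.swap)
  also have "(\<Sum>u\<in>?J. \<Sum>v\<in>?J. ?h (?m u v)) \<le> 8 * (9 * P)"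
    by (rule sum_max_dist_le[OF fin h0 sum_dilate_third_le[OF phi_nonneg phi_sum_le]])
  finally show ?thesis using prod[of s t] unfolding cov4_const_def by simp
qed

text \<open>
  Schur's test for the matrix \<open>cov4\<close>, whose rows and columns are indexed by pairs.
\<close>

lemma distinct_cov_sum_le:
  assumes fin: "finite I"
  shows "\<bar>distinct_sum I (\<lambda>s t u v. a s t * a u v * (\<mu> s t u v - \<gamma> s t * \<gamma> u v))\<bar>
     \<le> cov4_const * (\<Sum>s\<in>I. \<Sum>t\<in>I. (a s t)\<^sup>2)"
proof -
  have pairs: "(\<Sum>p\<in>I \<times> I. f p) = (\<Sum>s\<in>I. \<Sum>t\<in>I. f (s, t))" for f :: "int \<times> int \<Rightarrow> real"
    by (simp add: sum.cartesian_product)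
  let ?c = "\<lambda>p q. cov4 (fst p) (snd p) (fst q) (snd q)"
  have sym: "?c p q = ?c q p" for p q
  proof -
    have "\<mu> s t u v = \<mu> u v s t" for s t u v
      unfolding \<mu>_def by (simp add: mult_ac)
    then show ?thesis unfolding cov4_def by (auto simp: mult.commute)
  qed
  have "distinct_sum I (\<lambda>s t u v. a s t * a u v * (\<mu> s t u v - \<gamma> s t * \<gamma> u v))
     = (\<Sum>s\<in>I. \<Sum>t\<in>I. \<Sum>u\<in>I. \<Sum>v\<in>I. a s t * a u v * cov4 s t u v)"
    unfolding distinct_sum_def cov4_def by (intro sum.cong refl) auto
  also have "\<bar>\<dots>\<bar> \<le> (\<Sum>s\<in>I. \<Sum>t\<in>I. \<Sum>u\<in>I. \<Sum>v\<in>I. \<bar>a s t * a u v * cov4 s t u v\<bar>)"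
    by (intro order_trans[OF sum_abs] sum_mono order_refl)
  also have "\<dots> = (\<Sum>p\<in>I \<times> I. \<Sum>q\<in>I \<times> I. \<bar>a (fst p) (snd p) * a (fst q) (snd q) * ?c p q\<bar>)"
    by (simp add: pairs)
  also have "\<dots> \<le> cov4_const * (\<Sum>p\<in>I \<times> I. (a (fst p) (snd p))\<^sup>2)"
  proof (rule schur_test)
    show "(\<Sum>q\<in>I \<times> I. \<bar>?c p q\<bar>) \<le> cov4_const" for p
      using cov4_sum_le[OF fin] by (simp add: pairs)
  qed (rule sym)
  also have "(\<Sum>p\<in>I \<times> I. (a (fst p) (snd p))\<^sup>2) = (\<Sum>s\<in>I. \<Sum>t\<in>I. (a s t)\<^sup>2)"
    by (simp add: pairs)
  finally show ?thesis .
qed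

section \<open>The fourth moment of a linear form\<close>

definition quartic_const :: real where "quartic_const = 4 * (\<Gamma>\<^sup>2 + cov4_const) + 292 * Q"

lemma expectation_squares_le: "expectation (\<lambda>\<omega>. (X s \<omega>)\<^sup>2 * (X t \<omega>)\<^sup>2) \<le> Q"
  and integrable_squares: "integrable M (\<lambda>\<omega>. (X s \<omega>)\<^sup>2 * (X t \<omega>)\<^sup>2)"
proof -
  show int: "integrable M (\<lambda>\<omega>. (X s \<omega>)\<^sup>2 * (X t \<omega>)\<^sup>2)"
    using integrable_X_mult4[of s s t t] by (simp add: power2_eq_square mult.assoc)
  have "expectation (\<lambda>\<omega>. (X s \<omega>)\<^sup>2 * (X t \<omega>)\<^sup>2) \<le> expectation (\<lambda>\<omega>. (X s \<omega> ^ 4 + X t \<omega> ^ 4) / 2)"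
  proof (intro integral_mono int)
    show "(X s \<omega>)\<^sup>2 * (X t \<omega>)\<^sup>2 \<le> (X s \<omega> ^ 4 + X t \<omega> ^ 4) / 2" for \<omega>
      using abs_mult_le_half_squares[of "(X s \<omega>)\<^sup>2" "(X t \<omega>)\<^sup>2"] by (simp add: power_mult[symmetric])
  qed (simp add: integrable_X4)
  also have "\<dots> \<le> Q"
    using expectation_X4_le[of s] expectation_X4_le[of t] by (simp add: integrable_X4)
  finally show "expectation (\<lambda>\<omega>. (X s \<omega>)\<^sup>2 * (X t \<omega>)\<^sup>2) \<le> Q" .
qed

text \<open>
  The fourth moment is of the order of the square of the sum of the squared coefficients, as for
  independent variables. In the sum over distinct indices, \<open>\<mu> s t u v\<close> splits into \<open>\<gamma> s t * \<gamma> u v\<close>,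
  whose weighted sum factorises, and a covariance, to which \<open>distinct_cov_sum_le\<close> applies.
\<close>

lemma linear_form_fourth_moment:
  assumes fin: "finite I" and W: "(\<Sum>t\<in>I. (w t)\<^sup>2) \<le> W"
  shows "integrable M (\<lambda>\<omega>. (\<Sum>t\<in>I. w t * X t \<omega>) ^ 4)"
    and "expectation (\<lambda>\<omega>. (\<Sum>t\<in>I. w t * X t \<omega>) ^ 4) \<le> quartic_const * W\<^sup>2"
proof -
  let ?Y = "\<lambda>\<omega>. \<Sum>t\<in>I. w t * X t \<omega>"
  define f where "f s t u v \<omega> = (w s * X s \<omega>) * (w t * X t \<omega>) * (w u * X u \<omega>) * (w v * X v \<omega>)" for s t u v \<omega>
  have f_eq: "f s t u v \<omega> = (w s * w t * (w u * w v)) * (X s \<omega> * X t \<omega> * X u \<omega> * X v \<omega>)" for s t u v \<omega>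
    unfolding f_def by (simp add: mult_ac)
  have intf: "integrable M (f s t u v)" for s t u v
    unfolding f_eq by (intro integrable_mult_right integrable_X_mult4)
  have Ef: "expectation (f s t u v) = w s * w t * (w u * w v) * \<mu> s t u v" for s t u v
    unfolding f_eq \<mu>_def by simp
  have W0: "0 \<le> W" using sum_nonneg[of I "\<lambda>t. (w t)\<^sup>2"] W by force
  let ?g = "\<lambda>\<omega>. 4 * distinct_sum I (\<lambda>s t u v. f s t u v \<omega>) + 292 * (\<Sum>t\<in>I. (w t * X t \<omega>)\<^sup>2)\<^sup>2"
  have pt: "?Y \<omega> ^ 4 \<le> ?g \<omega>" for \<omega>
    unfolding f_def by (rule quartic_le_distinct_sum[OF fin])
  have sq: "(\<Sum>t\<in>I. (w t * X t \<omega>)\<^sup>2)\<^sup>2 = (\<Sum>s\<in>I. \<Sum>t\<in>I. ((w s)\<^sup>2 * (w t)\<^sup>2) * ((X s \<omega>)\<^sup>2 * (X t \<omega>)\<^sup>2))" for \<omega>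
    unfolding power2_eq_square[of "sum _ _"] sum_product by (simp add: power_mult_distrib mult_ac)
  have intsq: "integrable M (\<lambda>\<omega>. (\<Sum>t\<in>I. (w t * X t \<omega>)\<^sup>2)\<^sup>2)"
    unfolding sq by (intro Bochner_Integration.integrable_sum integrable_mult_right integrable_squares)
  have intg: "integrable M ?g"
    by (intro Bochner_Integration.integrable_add integrable_mult_right intsq integral_distinct_sum(1) intf)
  show intY: "integrable M (\<lambda>\<omega>. ?Y \<omega> ^ 4)"
  proof (rule Bochner_Integration.integrable_bound[OF intg])
    have "norm (?Y \<omega> ^ 4) \<le> norm (?g \<omega>)" for \<omega>
      using pt[of \<omega>] by (simp only: real_norm_def) (smt (verit) zero_le_even_power even_numeral)
    then show "AE \<omega> in M. norm (?Y \<omega> ^ 4) \<le> norm (?g \<omega>)" by simp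
  qed measurable
  have wsq: "(\<Sum>s\<in>I. \<Sum>t\<in>I. (w s * w t)\<^sup>2) \<le> W\<^sup>2"
  proof -
    have "(\<Sum>s\<in>I. \<Sum>t\<in>I. (w s * w t)\<^sup>2) = (\<Sum>t\<in>I. (w t)\<^sup>2)\<^sup>2"
      unfolding power2_eq_square[of "sum _ _"] sum_product by (simp add: power_mult_distrib)
    also have "\<dots> \<le> W\<^sup>2" using W by (intro power_mono sum_nonneg) auto
    finally show ?thesis .
  qed
  have dist: "expectation (\<lambda>\<omega>. distinct_sum I (\<lambda>s t u v. f s t u v \<omega>)) \<le> (cov4_const + \<Gamma>\<^sup>2) * W\<^sup>2"
  proof -
    have "expectation (\<lambda>\<omega>. distinct_sum I (\<lambda>s t u v. f s t u v \<omega>))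
        = distinct_sum I (\<lambda>s t u v. w s * w t * (w u * w v) * (\<mu> s t u v - \<gamma> s t * \<gamma> u v)
            + w s * w t * (w u * w v) * (\<gamma> s t * \<gamma> u v))"
      unfolding integral_distinct_sum(2)[OF intf] Ef by (simp add: algebra_simps)
    also have "\<dots> = distinct_sum I (\<lambda>s t u v. w s * w t * (w u * w v) * (\<mu> s t u v - \<gamma> s t * \<gamma> u v))
        + distinct_sum I (\<lambda>s t u v. w s * w t * (w u * w v) * (\<gamma> s t * \<gamma> u v))"
      by (rule distinct_sum_add)
    also have "\<dots> \<le> cov4_const * W\<^sup>2 + (\<Gamma> * W)\<^sup>2"
    proof (rule add_mono)
      show "distinct_sum I (\<lambda>s t u v. w s * w t * (w u * w v) * (\<mu> s t u v - \<gamma> s t * \<gamma> u v)) \<le> cov4_const * W\<^sup>2"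
        using distinct_cov_sum_le[OF fin, of "\<lambda>s t. w s * w t"] mult_left_mono[OF wsq cov4_const_nonneg] by linarith
      have "distinct_sum I (\<lambda>s t u v. w s * w t * (w u * w v) * (\<gamma> s t * \<gamma> u v))
          \<le> (\<Sum>s\<in>I. \<Sum>t\<in>I. \<Sum>u\<in>I. \<Sum>v\<in>I. \<bar>w s * w t * \<gamma> s t\<bar> * \<bar>w u * w v * \<gamma> u v\<bar>)"
        unfolding distinct_sum_def by (intro sum_mono) (auto simp: abs_mult[symmetric] mult_ac)
      also have "\<dots> = (\<Sum>s\<in>I. \<Sum>t\<in>I. \<bar>w s * w t * \<gamma> s t\<bar>)\<^sup>2"
        unfolding power2_eq_square sum_distrib_right unfolding sum_distrib_left by (rule refl)
      also have "\<dots> \<le> (\<Gamma> * W)\<^sup>2"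
      proof (rule power_mono)
        have "(\<Sum>s\<in>I. \<Sum>t\<in>I. \<bar>w s * w t * \<gamma> s t\<bar>) \<le> \<Gamma> * (\<Sum>t\<in>I. (w t)\<^sup>2)"
          by (rule schur_test) (auto simp: gamma_commute intro: gamma_sum_le[OF fin])
        also have "\<dots> \<le> \<Gamma> * W" using W Gamma_pos by (intro mult_left_mono) auto
        finally show "(\<Sum>s\<in>I. \<Sum>t\<in>I. \<bar>w s * w t * \<gamma> s t\<bar>) \<le> \<Gamma> * W" .
      qed (intro sum_nonneg, simp)
      finally show "distinct_sum I (\<lambda>s t u v. w s * w t * (w u * w v) * (\<gamma> s t * \<gamma> u v)) \<le> (\<Gamma> * W)\<^sup>2" .
    qed
    finally show ?thesis by (simp add: algebra_simps power_mult_distrib)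
  qed
  have square: "expectation (\<lambda>\<omega>. (\<Sum>t\<in>I. (w t * X t \<omega>)\<^sup>2)\<^sup>2) \<le> Q * W\<^sup>2"
  proof -
    have "expectation (\<lambda>\<omega>. (\<Sum>t\<in>I. (w t * X t \<omega>)\<^sup>2)\<^sup>2)
        = (\<Sum>s\<in>I. \<Sum>t\<in>I. ((w s)\<^sup>2 * (w t)\<^sup>2) * expectation (\<lambda>\<omega>. (X s \<omega>)\<^sup>2 * (X t \<omega>)\<^sup>2))"
      unfolding sq by (simp add: Bochner_Integration.integral_sum Bochner_Integration.integrable_sum integrable_squares)
    also have "\<dots> \<le> (\<Sum>s\<in>I. \<Sum>t\<in>I. ((w s)\<^sup>2 * (w t)\<^sup>2) * Q)"
      by (intro sum_mono mult_left_mono expectation_squares_le) auto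
    also have "\<dots> = (\<Sum>s\<in>I. \<Sum>t\<in>I. (w s * w t)\<^sup>2) * Q"
      by (simp add: sum_distrib_right power_mult_distrib)
    also have "\<dots> \<le> W\<^sup>2 * Q" using wsq Q_nonneg by (rule mult_right_mono)
    finally show ?thesis by (simp add: mult.commute)
  qed
  have "expectation (\<lambda>\<omega>. ?Y \<omega> ^ 4) \<le> expectation ?g"
    by (intro integral_mono intY intg pt)
  also have "\<dots> = 4 * expectation (\<lambda>\<omega>. distinct_sum I (\<lambda>s t u v. f s t u v \<omega>))
      + 292 * expectation (\<lambda>\<omega>. (\<Sum>t\<in>I. (w t * X t \<omega>)\<^sup>2)\<^sup>2)"
    by (subst Bochner_Integration.integral_add)
       (auto intro!: integrable_mult_right intsq integral_distinct_sum(1) intf)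
  also have "\<dots> \<le> 4 * ((cov4_const + \<Gamma>\<^sup>2) * W\<^sup>2) + 292 * (Q * W\<^sup>2)"
    using dist square by simp
  also have "\<dots> = quartic_const * W\<^sup>2" unfolding quartic_const_def by (simp add: algebra_simps)
  finally show "expectation (\<lambda>\<omega>. ?Y \<omega> ^ 4) \<le> quartic_const * W\<^sup>2" .
qed

section \<open>The mean square error\<close>

definition variance_const :: real where "variance_const = cov4_const + 2 * (Q + quartic_const) + 2"

text \<open>
  By \<open>offdiagonal_square\<close> the second moment consists of a sum over distinct indices and of the
  \<open>X s ^ 2 * Y s ^ 2\<close>, where \<open>Y s\<close> is the linear form with coefficients \<open>a s t\<close>. The same identity for the
  numbers \<open>a s t * \<gamma> s t\<close> expands the squared expectation, and the difference of the two sums over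
  distinct indices is a sum of covariances.
\<close>

lemma quadratic_form_variance_le:
  assumes fin: "finite I"
    and sym: "\<And>s t. s \<in> I \<Longrightarrow> t \<in> I \<Longrightarrow> a s t = a t s"
    and diag: "\<And>s. s \<in> I \<Longrightarrow> a s s = 0"
    and W: "\<And>s. s \<in> I \<Longrightarrow> (\<Sum>t\<in>I. (a s t)\<^sup>2) \<le> W" "0 < W"
  defines "A \<equiv> \<lambda>\<omega>. \<Sum>s\<in>I. \<Sum>t\<in>I. a s t * (X s \<omega> * X t \<omega>)"
  shows "integrable M A" "integrable M (\<lambda>\<omega>. (A \<omega>)\<^sup>2)" "variance A \<le> variance_const * real (card I) * W"
proof -
  define Y where "Y s \<omega> = (\<Sum>t\<in>I. a s t * X t \<omega>)" for s \<omega>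
  define f where "f s t u v \<omega> = (a s t * (X s \<omega> * X t \<omega>)) * (a u v * (X u \<omega> * X v \<omega>))" for s t u v \<omega>
  have f_eq: "f s t u v \<omega> = (a s t * a u v) * (X s \<omega> * X t \<omega> * X u \<omega> * X v \<omega>)" for s t u v \<omega>
    unfolding f_def by (simp add: mult_ac)
  have intf: "integrable M (f s t u v)" for s t u v
    unfolding f_eq by (intro integrable_mult_right integrable_X_mult4)
  have Ef: "expectation (f s t u v) = a s t * a u v * \<mu> s t u v" for s t u v
    unfolding f_eq \<mu>_def by simp
  show intA: "integrable M A"
    unfolding A_def by (intro Bochner_Integration.integrable_sum integrable_mult_right integrable_X_mult2)
  have EA: "expectation A = (\<Sum>s\<in>I. \<Sum>t\<in>I. a s t * \<gamma> s t)"
    unfolding A_def \<gamma>_def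
    by (simp add: Bochner_Integration.integral_sum Bochner_Integration.integrable_sum integrable_X_mult2)
  have A2: "(A \<omega>)\<^sup>2 = (\<Sum>s\<in>I. \<Sum>t\<in>I. \<Sum>u\<in>I. \<Sum>v\<in>I. f s t u v \<omega>)" for \<omega>
    unfolding A_def f_def power2_eq_square sum_distrib_right unfolding sum_distrib_left by (rule refl)
  show intA2: "integrable M (\<lambda>\<omega>. (A \<omega>)\<^sup>2)"
    unfolding A2 by (intro Bochner_Integration.integrable_sum intf)
  have row: "(\<Sum>t\<in>I. a s t * (X s \<omega> * X t \<omega>)) = X s \<omega> * Y s \<omega>" for s \<omega>
    unfolding Y_def by (simp add: sum_distrib_left mult_ac)
  have intY: "integrable M (\<lambda>\<omega>. Y s \<omega> ^ 4)" "expectation (\<lambda>\<omega>. Y s \<omega> ^ 4) \<le> quartic_const * W\<^sup>2" if "s \<in> I" for s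
    unfolding Y_def using linear_form_fourth_moment[OF fin W(1)[OF that]] by simp_all
  let ?h = "\<lambda>s \<omega>. W / 2 * X s \<omega> ^ 4 + 1 / (2 * W) * Y s \<omega> ^ 4"
  \<comment> \<open>Weighted so that both terms have expectation of order \<open>W\<close>.\<close>
  have young: "(X s \<omega> * Y s \<omega>)\<^sup>2 \<le> ?h s \<omega>" for s \<omega>
  proof -
    have "0 \<le> (W * (X s \<omega>)\<^sup>2 - (Y s \<omega>)\<^sup>2)\<^sup>2 / (2 * W)" using W(2) by simp
    also have "\<dots> = ?h s \<omega> - (X s \<omega> * Y s \<omega>)\<^sup>2"
      using W(2) by (simp add: power2_diff power_mult_distrib power_mult[symmetric] field_simps power2_eq_square[of W])
    finally show ?thesis by simp
  qed
  have inth: "integrable M (?h s)" if "s \<in> I" for s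
    by (intro Bochner_Integration.integrable_add integrable_mult_right integrable_X4 intY that)
  have Eh: "expectation (?h s) \<le> W / 2 * (Q + quartic_const)" if s: "s \<in> I" for s
  proof -
    have "expectation (?h s) = W / 2 * expectation (\<lambda>\<omega>. X s \<omega> ^ 4) + 1 / (2 * W) * expectation (\<lambda>\<omega>. Y s \<omega> ^ 4)"
      using integrable_X4[of s] intY(1)[OF s] by simp
    also have "\<dots> \<le> W / 2 * Q + 1 / (2 * W) * (quartic_const * W\<^sup>2)"
      using W(2) by (intro add_mono mult_left_mono expectation_X4_le intY(2) s) auto
    also have "\<dots> = W / 2 * (Q + quartic_const)" using W(2) by (simp add: power2_eq_square field_simps)
    finally show ?thesis .
  qed
  have ptA2: "(A \<omega>)\<^sup>2 \<le> distinct_sum I (\<lambda>s t u v. f s t u v \<omega>) + 4 * (\<Sum>s\<in>I. ?h s \<omega>)" for \<omega>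
  proof -
    have "(A \<omega>)\<^sup>2 = distinct_sum I (\<lambda>s t u v. f s t u v \<omega>)
        + 4 * (\<Sum>s\<in>I. (X s \<omega> * Y s \<omega>)\<^sup>2) - 2 * (\<Sum>s\<in>I. \<Sum>t\<in>I. (a s t * (X s \<omega> * X t \<omega>))\<^sup>2)"
      unfolding A_def f_def row[symmetric]
      by (rule offdiagonal_square[OF fin]) (auto simp: sym diag mult.commute)
    moreover have "0 \<le> (\<Sum>s\<in>I. \<Sum>t\<in>I. (a s t * (X s \<omega> * X t \<omega>))\<^sup>2)" by (intro sum_nonneg) auto
    moreover have "(\<Sum>s\<in>I. (X s \<omega> * Y s \<omega>)\<^sup>2) \<le> (\<Sum>s\<in>I. ?h s \<omega>)" by (intro sum_mono young)
    ultimately show ?thesis by linarith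
  qed
  have intS: "integrable M (\<lambda>\<omega>. \<Sum>s\<in>I. ?h s \<omega>)"
    by (rule Bochner_Integration.integrable_sum) (rule inth)
  have ES: "expectation (\<lambda>\<omega>. \<Sum>s\<in>I. ?h s \<omega>) \<le> real (card I) * (W / 2 * (Q + quartic_const))"
  proof -
    have "expectation (\<lambda>\<omega>. \<Sum>s\<in>I. ?h s \<omega>) = (\<Sum>s\<in>I. expectation (?h s))"
      by (rule Bochner_Integration.integral_sum) (rule inth)
    also have "\<dots> \<le> (\<Sum>s\<in>I. W / 2 * (Q + quartic_const))" by (intro sum_mono Eh)
    finally show ?thesis by simp
  qed
  have "expectation (\<lambda>\<omega>. (A \<omega>)\<^sup>2)
      \<le> expectation (\<lambda>\<omega>. distinct_sum I (\<lambda>s t u v. f s t u v \<omega>) + 4 * (\<Sum>s\<in>I. ?h s \<omega>))"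
    by (intro integral_mono intA2 ptA2 Bochner_Integration.integrable_add integrable_mult_right
        integral_distinct_sum(1) intf intS)
  also have "\<dots> = distinct_sum I (\<lambda>s t u v. a s t * a u v * \<mu> s t u v)
      + 4 * expectation (\<lambda>\<omega>. \<Sum>s\<in>I. ?h s \<omega>)"
    using intS integral_distinct_sum[OF intf, of I]
    by (subst Bochner_Integration.integral_add) (simp_all only: integrable_mult_right integral_mult_right_zero Ef)
  finally have EA2: "expectation (\<lambda>\<omega>. (A \<omega>)\<^sup>2) \<le> distinct_sum I (\<lambda>s t u v. a s t * a u v * \<mu> s t u v)
      + 4 * (real (card I) * (W / 2 * (Q + quartic_const)))"
    using ES by linarith
  have asq: "(\<Sum>s\<in>I. \<Sum>t\<in>I. (a s t)\<^sup>2) \<le> real (card I) * W"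
    using sum_mono[of I "\<lambda>s. \<Sum>t\<in>I. (a s t)\<^sup>2" "\<lambda>_. W", OF W(1)] by simp
  have agam: "(\<Sum>s\<in>I. \<Sum>t\<in>I. (a s t * \<gamma> s t)\<^sup>2) \<le> real (card I) * W"
  proof -
    have "(a s t * \<gamma> s t)\<^sup>2 \<le> (a s t)\<^sup>2" for s t
      using mult_left_mono[OF power_mono[OF gamma_le_1[of s t], of 2], of "(a s t)\<^sup>2"]
      by (simp add: power_mult_distrib)
    then have "(\<Sum>s\<in>I. \<Sum>t\<in>I. (a s t * \<gamma> s t)\<^sup>2) \<le> (\<Sum>s\<in>I. \<Sum>t\<in>I. (a s t)\<^sup>2)"
      by (intro sum_mono)
    with asq show ?thesis by linarith
  qed
  have "(expectation A)\<^sup>2 = distinct_sum I (\<lambda>s t u v. (a s t * \<gamma> s t) * (a u v * \<gamma> u v))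
      + 4 * (\<Sum>s\<in>I. (\<Sum>t\<in>I. a s t * \<gamma> s t)\<^sup>2) - 2 * (\<Sum>s\<in>I. \<Sum>t\<in>I. (a s t * \<gamma> s t)\<^sup>2)"
    unfolding EA by (rule offdiagonal_square[OF fin]) (auto simp: sym diag gamma_commute)
  moreover have "0 \<le> (\<Sum>s\<in>I. (\<Sum>t\<in>I. a s t * \<gamma> s t)\<^sup>2)" by (intro sum_nonneg) auto
  moreover have "distinct_sum I (\<lambda>s t u v. a s t * a u v * \<mu> s t u v)
      = distinct_sum I (\<lambda>s t u v. a s t * a u v * (\<mu> s t u v - \<gamma> s t * \<gamma> u v))
      + distinct_sum I (\<lambda>s t u v. (a s t * \<gamma> s t) * (a u v * \<gamma> u v))"
    unfolding distinct_sum_add[symmetric] by (rule distinct_sum_cong) (simp add: algebra_simps)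
  moreover have "distinct_sum I (\<lambda>s t u v. a s t * a u v * (\<mu> s t u v - \<gamma> s t * \<gamma> u v))
      \<le> cov4_const * (real (card I) * W)"
    using distinct_cov_sum_le[OF fin, of a] mult_left_mono[OF asq cov4_const_nonneg] by linarith
  ultimately have "expectation (\<lambda>\<omega>. (A \<omega>)\<^sup>2) - (expectation A)\<^sup>2
      \<le> cov4_const * (real (card I) * W) + 4 * (real (card I) * (W / 2 * (Q + quartic_const))) + 2 * (real (card I) * W)"
    using EA2 agam by linarith
  also have "\<dots> = variance_const * real (card I) * W" unfolding variance_const_def by (simp add: algebra_simps)
  finally show "variance A \<le> variance_const * real (card I) * W"
    using variance_eq[OF intA intA2] by simp
qed

text \<open>
  A one-sided bound on the covariances of the squares is enough for a variance.
\<close>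

lemma sum_squares_variance_le:
  assumes fin: "finite I"
  defines "D \<equiv> \<lambda>\<omega>. \<Sum>s\<in>I. (X s \<omega>)\<^sup>2"
  shows "integrable M D" "integrable M (\<lambda>\<omega>. (D \<omega>)\<^sup>2)" "variance D \<le> real (card I) * (Q + 2 * R)"
proof -
  have D2: "(D \<omega>)\<^sup>2 = (\<Sum>s\<in>I. \<Sum>t\<in>I. (X s \<omega>)\<^sup>2 * (X t \<omega>)\<^sup>2)" for \<omega>
    unfolding D_def power2_eq_square[of "sum _ _"] sum_product by (rule refl)
  let ?e = "\<lambda>s. expectation (\<lambda>\<omega>. (X s \<omega>)\<^sup>2)"
  let ?c = "\<lambda>s t. expectation (\<lambda>\<omega>. (X s \<omega>)\<^sup>2 * (X t \<omega>)\<^sup>2) - ?e s * ?e t"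
  show intD: "integrable M D"
    unfolding D_def by (intro Bochner_Integration.integrable_sum integrable_X_square)
  show intD2: "integrable M (\<lambda>\<omega>. (D \<omega>)\<^sup>2)"
    unfolding D2 by (intro Bochner_Integration.integrable_sum integrable_squares)
  have "expectation D = (\<Sum>s\<in>I. ?e s)"
    unfolding D_def by (rule Bochner_Integration.integral_sum) (rule integrable_X_square)
  then have ED2: "(expectation D)\<^sup>2 = (\<Sum>s\<in>I. \<Sum>t\<in>I. ?e s * ?e t)"
    by (simp add: power2_eq_square sum_product)
  have "expectation (\<lambda>\<omega>. (D \<omega>)\<^sup>2) = (\<Sum>s\<in>I. \<Sum>t\<in>I. expectation (\<lambda>\<omega>. (X s \<omega>)\<^sup>2 * (X t \<omega>)\<^sup>2))"
    unfolding D2 by (simp add: Bochner_Integration.integral_sum Bochner_Integration.integrable_sum integrable_squares)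
  then have var: "variance D = (\<Sum>s\<in>I. \<Sum>t\<in>I. ?c s t)"
    using variance_eq[OF intD intD2] ED2 by (simp add: sum_subtractf)
  have offdiag: "?c s t \<le> \<psi> (nat \<bar>s - t\<bar>)" if "s \<noteq> t" for s t
  proof -
    have cov: "covariance M (\<lambda>\<omega>. (X i \<omega>)\<^sup>2) (\<lambda>\<omega>. (X j \<omega>)\<^sup>2) = ?c i j" for i j
      by (rule covariance_eq[OF integrable_X_square integrable_X_square integrable_squares])
    show ?thesis
    proof (cases "s < t")
      case True
      then have "nat \<bar>s - t\<bar> = nat (t - s)" by simp
      then show ?thesis using cov_squares[OF True] unfolding cov by simp
    next
      case False
      with that have "t < s" "nat \<bar>s - t\<bar> = nat (s - t)" by auto
      moreover have "?c s t = ?c t s" by (simp only: mult.commute)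
      ultimately show ?thesis using cov_squares[of t s] unfolding cov by presburger
    qed
  qed
  have row: "(\<Sum>t\<in>I. ?c s t) \<le> Q + 2 * R" if s: "s \<in> I" for s
  proof -
    have "(\<Sum>t\<in>I. ?c s t) = ?c s s + (\<Sum>t\<in>I - {s}. ?c s t)"
      using fin s by (rule sum.remove)
    also have "\<dots> \<le> Q + (\<Sum>t\<in>I - {s}. \<psi> (nat \<bar>s - t\<bar>))"
    proof (intro add_mono sum_mono offdiag)
      show "?c s s \<le> Q" using expectation_squares_le[of s s] zero_le_square[of "?e s"] by linarith
    qed auto
    also have "(\<Sum>t\<in>I - {s}. \<psi> (nat \<bar>s - t\<bar>)) \<le> 2 * R"
      by (rule sum_nat_dist_le[OF fin psi_nonneg psi_sum_le])
    finally show ?thesis by simp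
  qed
  have "variance D \<le> (\<Sum>s\<in>I. Q + 2 * R)"
    unfolding var by (intro sum_mono row)
  then show "variance D \<le> real (card I) * (Q + 2 * R)" by simp
qed

lemma mean_square_error_le:
  fixes K :: "real \<Rightarrow> real"
  assumes n: "0 < n" and K0: "K 0 = 1"
    and W: "\<And>s. (\<Sum>t = 1..int n. (K (real_of_int \<bar>s - t\<bar> / m))\<^sup>2) \<le> W" "0 < W"
  shows "(\<integral>\<^sup>+\<omega>. ennreal (\<bar>sigma_hat_sq K X m n \<omega> - c\<bar>\<^sup>2) \<partial>M)
    \<le> ennreal (3 * (variance_const * (W / real n)) + 3 * ((Q + 2 * R) / real n)
       + 3 * (1 / real n * (\<Sum>s = 1..int n. \<Sum>t = 1..int n. K (real_of_int \<bar>s - t\<bar> / m) * \<gamma> s t) - c)\<^sup>2)"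
proof -
  let ?I = "{1..int n}"
  let ?k = "\<lambda>s t. K (real_of_int \<bar>s - t\<bar> / m)"
  define a where "a s t = (if s = t then 0 else ?k s t)" for s t
  define A where "A = (\<lambda>\<omega>. \<Sum>s\<in>?I. \<Sum>t\<in>?I. a s t * (X s \<omega> * X t \<omega>))"
  define D where "D = (\<lambda>\<omega>. \<Sum>s\<in>?I. (X s \<omega>)\<^sup>2)"
  define e where "e = 1 / real n * (\<Sum>s\<in>?I. \<Sum>t\<in>?I. ?k s t * \<gamma> s t)"
  have aW: "(\<Sum>t\<in>?I. (a s t)\<^sup>2) \<le> W" for s
  proof -
    have "(\<Sum>t\<in>?I. (a s t)\<^sup>2) \<le> (\<Sum>t\<in>?I. (?k s t)\<^sup>2)"
      by (intro sum_mono) (simp add: a_def)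
    with W(1)[of s] show ?thesis by linarith
  qed
  have varA: "integrable M A" "integrable M (\<lambda>\<omega>. (A \<omega>)\<^sup>2)" "variance A \<le> variance_const * real n * W"
    unfolding A_def
    using quadratic_form_variance_le[of ?I a W, OF _ _ _ aW W(2)] by (simp_all add: a_def abs_minus_commute)
  have varD: "integrable M D" "integrable M (\<lambda>\<omega>. (D \<omega>)\<^sup>2)" "variance D \<le> real n * (Q + 2 * R)"
    unfolding D_def using sum_squares_variance_le[of ?I] by simp_all
  have split: "(\<Sum>s\<in>?I. \<Sum>t\<in>?I. ?k s t * g s t) = (\<Sum>s\<in>?I. \<Sum>t\<in>?I. a s t * g s t) + (\<Sum>s\<in>?I. g s s)"
    for g :: "int \<Rightarrow> int \<Rightarrow> real"
  proof -
    have "?k s t * g s t = a s t * g s t + (if s = t then g s t else 0)" for s t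
      using K0 by (simp add: a_def)
    then show ?thesis by (simp add: sum.distrib)
  qed
  have hat: "sigma_hat_sq K X m n \<omega> = 1 / real n * (A \<omega> + D \<omega>)" for \<omega>
    using split[of "\<lambda>s t. X s \<omega> * X t \<omega>"]
    by (simp only: sigma_hat_sq_def A_def D_def power2_eq_square mult.assoc)
  have Ehat: "e = 1 / real n * (expectation A + expectation D)"
  proof -
    have "expectation A = (\<Sum>s\<in>?I. \<Sum>t\<in>?I. a s t * \<gamma> s t)"
      unfolding A_def \<gamma>_def
      by (simp add: Bochner_Integration.integral_sum Bochner_Integration.integrable_sum integrable_X_mult2)
    moreover have "expectation D = (\<Sum>s\<in>?I. \<gamma> s s)"
      unfolding D_def \<gamma>_def power2_eq_square by (rule Bochner_Integration.integral_sum) (rule integrable_X_mult2)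
    ultimately show ?thesis unfolding e_def split by simp
  qed
  let ?g = "\<lambda>\<omega>. 3 / (real n)\<^sup>2 * (A \<omega> - expectation A)\<^sup>2 + 3 / (real n)\<^sup>2 * (D \<omega> - expectation D)\<^sup>2
      + 3 * (e - c)\<^sup>2"
  have three: "(x + y + z)\<^sup>2 \<le> 3 * x\<^sup>2 + 3 * y\<^sup>2 + 3 * z\<^sup>2" for x y z :: real
    using zero_le_power2[of "x - y"] zero_le_power2[of "y - z"] zero_le_power2[of "x - z"]
    by (simp add: power2_eq_square algebra_simps)
  have pt: "\<bar>sigma_hat_sq K X m n \<omega> - c\<bar>\<^sup>2 \<le> ?g \<omega>" for \<omega>
  proof -
    have eq: "sigma_hat_sq K X m n \<omega> - c
        = (A \<omega> - expectation A) / real n + (D \<omega> - expectation D) / real n + (e - c)"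
      unfolding hat Ehat using n by (simp add: field_simps)
    show ?thesis
      unfolding eq power2_abs
      using three[of "(A \<omega> - expectation A) / real n" "(D \<omega> - expectation D) / real n" "e - c"]
      by (simp add: power_divide)
  qed
  have int2: "integrable M (\<lambda>\<omega>. (Z \<omega> - expectation Z)\<^sup>2)"
    if "integrable M Z" "integrable M (\<lambda>\<omega>. (Z \<omega>)\<^sup>2)" for Z :: "'a \<Rightarrow> real"
    using that by (simp add: power2_diff)
  have intg: "integrable M ?g"
    using int2[OF varA(1,2)] int2[OF varD(1,2)] by simp
  have "(\<integral>\<^sup>+\<omega>. ennreal (\<bar>sigma_hat_sq K X m n \<omega> - c\<bar>\<^sup>2) \<partial>M) \<le> (\<integral>\<^sup>+\<omega>. ennreal (?g \<omega>) \<partial>M)"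
    by (intro nn_integral_mono ennreal_leI pt)
  also have "\<dots> = ennreal (expectation ?g)"
    by (rule nn_integral_eq_integral[OF intg]) simp
  also have "\<dots> \<le> ennreal (3 * (variance_const * (W / real n)) + 3 * ((Q + 2 * R) / real n) + 3 * (e - c)\<^sup>2)"
  proof (rule ennreal_leI)
    have "expectation ?g = 3 / (real n)\<^sup>2 * variance A + 3 / (real n)\<^sup>2 * variance D + 3 * (e - c)\<^sup>2"
      using int2[OF varA(1,2)] int2[OF varD(1,2)] by (simp add: prob_space)
    also have "\<dots> \<le> 3 / (real n)\<^sup>2 * (variance_const * real n * W) + 3 / (real n)\<^sup>2 * (real n * (Q + 2 * R)) + 3 * (e - c)\<^sup>2"
      by (intro add_mono mult_left_mono varA(3) varD(3)) auto
    also have "\<dots> = 3 * (variance_const * (W / real n)) + 3 * ((Q + 2 * R) / real n) + 3 * (e - c)\<^sup>2"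
      using n by (simp add: power2_eq_square field_simps)
    finally show "expectation ?g \<le> 3 * (variance_const * (W / real n)) + 3 * ((Q + 2 * R) / real n) + 3 * (e - c)\<^sup>2" .
  qed
  finally show ?thesis unfolding e_def .
qed

end

section \<open>Convergence in mean square\<close>

lemma ennreal_suminf_finite:
  fixes f :: "nat \<Rightarrow> real"
  assumes f0: "\<And>k. 1 \<le> k \<Longrightarrow> 0 \<le> f k" and fin: "(\<Sum>k. ennreal (f (Suc k))) < \<infinity>"
  shows "summable (\<lambda>k. f (Suc k))" "(\<Sum>k=1..N. f k) \<le> (\<Sum>k. f (Suc k))"
proof -
  show sm: "summable (\<lambda>k. f (Suc k))"
    using fin f0 by (intro summable_suminf_not_top) (auto simp: less_top)
  have "(\<Sum>k=1..N. f k) = (\<Sum>k<N. f (Suc k))"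
    by (rule sum.reindex_bij_witness[of _ Suc "\<lambda>k. k - 1"]) auto
  also have "\<dots> \<le> (\<Sum>k. f (Suc k))"
    using f0 by (intro sum_le_suminf sm) auto
  finally show "(\<Sum>k=1..N. f k) \<le> (\<Sum>k. f (Suc k))" .
qed

theorem theorem3p2:
  fixes M :: "'a measure"
    and X :: "int \<Rightarrow> 'a \<Rightarrow> real"
    and \<phi> \<psi> :: "nat \<Rightarrow> real"
    and K :: "real \<Rightarrow> real"
    and F :: "'i filter"
    and m :: "'i \<Rightarrow> real"
    and n :: "'i \<Rightarrow> nat"
    and t\<^sub>0 :: int
  assumes "prob_space M"
    and "weakly_stationary M X"
    and "\<And>t. (LINT \<omega>|M. X t \<omega>) = 0"
    and "\<And>t. (LINT \<omega>|M. (X t \<omega>)\<^sup>2) \<le> 1"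
    and "\<And>k. 1 \<le> k \<Longrightarrow> 0 \<le> \<phi> k"
    and "antimono_on {1..} \<phi>"
    and "\<And>i j k l. i < j \<Longrightarrow> j < k \<Longrightarrow> k < l \<Longrightarrow>
           \<bar>covariance M (X i) (\<lambda>\<omega>. X j \<omega> * X k \<omega> * X l \<omega>)\<bar> \<le> \<phi> (nat (j - i))"
    and "\<And>i j k l. i < j \<Longrightarrow> j < k \<Longrightarrow> k < l \<Longrightarrow>
           \<bar>covariance M (\<lambda>\<omega>. X i \<omega> * X j \<omega> * X k \<omega>) (X l)\<bar> \<le> \<phi> (nat (l - k))"
    and "\<And>i j k l. i < j \<Longrightarrow> j < k \<Longrightarrow> k < l \<Longrightarrow>
           \<bar>covariance M (\<lambda>\<omega>. X i \<omega> * X j \<omega>) (\<lambda>\<omega>. X k \<omega> * X l \<omega>)\<bar> \<le> \<phi> (nat (k - j))"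
    and "\<And>i j. i < j \<Longrightarrow> \<bar>covariance M (X i) (X j)\<bar> \<le> \<phi> (nat (j - i))"
    and "\<And>k. 1 \<le> k \<Longrightarrow> 0 \<le> \<psi> k"
    and "\<And>i j. i < j \<Longrightarrow>
           covariance M (\<lambda>\<omega>. (X i \<omega>)\<^sup>2) (\<lambda>\<omega>. (X j \<omega>)\<^sup>2) \<le> \<psi> (nat (j - i))"
    and "K 0 = 1"
    and "continuous (at 0 within {0..}) K"
    and "bdd_above ((\<lambda>x. \<bar>K x\<bar>) ` {0..})"
    and "(\<integral>\<^sup>+x\<in>{0..}. ennreal ((Kbar K x)\<^sup>2) \<partial>lborel) < \<infinity>"
    and "Phi0 M X < \<infinity>"
    and "Phi1 \<phi> < \<infinity>"
    and "Phi2 \<psi> < \<infinity>"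
    and "\<And>i. 0 < m i"
    and "filterlim m at_top F"
    and "filterlim n at_top F"
    and "m \<in> o[F](\<lambda>i. real (n i))"
  shows "(\<lambda>j. covariance M (X t\<^sub>0) (X (t\<^sub>0 + j))) summable_on UNIV \<and>
         tendsto_in_mean_square M (\<lambda>i. sigma_hat_sq K X (m i) (n i)) (sigma_sq M X t\<^sub>0) F"
proof -
  interpret prob_space M by fact
  let ?\<Phi>0 = "Phi0 M X"
  define Ck where "Ck = (Kbar K 0)\<^sup>2 + 2 * enn2real (\<integral>\<^sup>+x\<in>{0..}. ennreal ((Kbar K x)\<^sup>2) \<partial>lborel)"
  note stationary = assms(2)[unfolded weakly_stationary_def]
  have meas [measurable]: "X t \<in> borel_measurable M" for t
    using stationary by blast
  have moment: "(\<integral>\<^sup>+\<omega>. ennreal (X t \<omega> ^ 4) \<partial>M) \<le> ?\<Phi>0" for t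
    unfolding Phi0_def by (rule SUP_upper) simp
  have int4: "integrable M (\<lambda>\<omega>. X t \<omega> ^ 4)" for t
    using moment[of t] assms(17) by (intro integrableI_nonneg) (auto intro: le_less_trans)
  have E4: "expectation (\<lambda>\<omega>. X t \<omega> ^ 4) \<le> enn2real ?\<Phi>0" for t
  proof -
    have "ennreal (expectation (\<lambda>\<omega>. X t \<omega> ^ 4)) = (\<integral>\<^sup>+\<omega>. ennreal (X t \<omega> ^ 4) \<partial>M)"
      by (rule nn_integral_eq_integral[OF int4, symmetric]) simp
    also have "\<dots> \<le> ennreal (enn2real ?\<Phi>0)"
      using moment[of t] assms(17) by simp
    finally show ?thesis by (simp add: ennreal_le_iff)
  qed
  have "0 \<le> real k * \<phi> k" if "1 \<le> k" for k
    using assms(5)[OF that] by simp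
  note phi_sum = ennreal_suminf_finite[of "\<lambda>k. real k * \<phi> k", OF this assms(18)[unfolded Phi1_def]]
  note psi_sum = ennreal_suminf_finite(2)[of \<psi>, OF assms(11) assms(19)[unfolded Phi2_def]]
  interpret weakly_dependent_process M X \<phi> \<psi> "enn2real ?\<Phi>0"
      "\<Sum>k. real (Suc k) * \<phi> (Suc k)" "\<Sum>k. \<psi> (Suc k)"
  proof unfold_locales
    show "(\<Sum>k=1..N. real k * \<phi> k) \<le> (\<Sum>k. real (Suc k) * \<phi> (Suc k))" for N by (rule phi_sum(2))
    show "(\<Sum>k=1..N. \<psi> k) \<le> (\<Sum>k. \<psi> (Suc k))" for N by (rule psi_sum)
  qed (fact meas int4 E4 assms(3-12))+
  define r where "r d = \<gamma> 0 (int d)" for d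
  have shift: "\<gamma> s (s + j) = \<gamma> t (t + j)" for s t j
    using stationary unfolding cov_eq_gamma by blast
  have gamma_r: "\<gamma> s t = r (nat \<bar>s - t\<bar>)" for s t
  proof (cases "s \<le> t")
    case True
    then show ?thesis using shift[of s "t - s" 0] by (simp add: r_def)
  next
    case False
    then show ?thesis using shift[of t "s - t" 0] by (simp add: r_def gamma_commute[of s t])
  qed
  have r_sum: "summable (\<lambda>k. \<bar>r k\<bar>)"
  proof -
    have "\<bar>r (Suc k)\<bar> \<le> real (Suc k) * \<phi> (Suc k)" for k
    proof -
      have "\<bar>r (Suc k)\<bar> \<le> \<phi> (Suc k)"
        using gamma_le_phi[of 0 "int (Suc k)"] unfolding r_def by (simp del: of_nat_Suc)
      also have "\<dots> \<le> real (Suc k) * \<phi> (Suc k)"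
        using phi_nonneg[of "Suc k"] by (intro mult_le_cancel_right1[THEN iffD2]) auto
      finally show ?thesis .
    qed
    then have "summable (\<lambda>k. \<bar>r (Suc k)\<bar>)"
      by (intro summable_comparison_test'[OF phi_sum(1)]) auto
    then show ?thesis by (simp add: summable_Suc_iff[of "\<lambda>k. \<bar>r k\<bar>"])
  qed
  have has: "((\<lambda>j. covariance M (X t\<^sub>0) (X (t\<^sub>0 + j))) has_sum (r 0 + 2 * (\<Sum>k. r (Suc k)))) UNIV"
    using has_sum_int_even[OF r_sum] by (simp add: cov_eq_gamma gamma_r)
  then have sigma: "sigma_sq M X t\<^sub>0 = r 0 + 2 * (\<Sum>k. r (Suc k))"
    unfolding sigma_sq_def by (rule infsumI)
  define mean where "mean i = 1 / real (n i) * (\<Sum>s = 1..int (n i). \<Sum>t = 1..int (n i).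
      K (real_of_int \<bar>s - t\<bar> / m i) * \<gamma> s t)" for i
  have mean: "(mean \<longlongrightarrow> sigma_sq M X t\<^sub>0) F"
    unfolding mean_def sigma gamma_r
    by (rule weighted_mean_tendsto[OF assms(13,14,15) r_sum assms(20,21,22)])
  have Ck: "0 < Ck"
  proof -
    have "1 \<le> Kbar K 0"
      using abs_le_Kbar[OF assms(15), of 0 0] assms(13) by simp
    then show ?thesis unfolding Ck_def by (intro add_pos_nonneg) auto
  qed
  let ?bound = "\<lambda>i. 3 * (variance_const * (Ck * m i / real (n i))) + 3 * ((enn2real ?\<Phi>0 + 2 * (\<Sum>k. \<psi> (Suc k))) / real (n i))
      + 3 * (mean i - sigma_sq M X t\<^sub>0)\<^sup>2"
  have ratio: "((\<lambda>i. m i / real (n i)) \<longlongrightarrow> 0) F"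
    by (rule smalloD_tendsto[OF assms(23)])
  have nreal: "filterlim (\<lambda>i. real (n i)) at_infinity F"
    by (intro filterlim_at_top_imp_at_infinity filterlim_compose[OF filterlim_real_sequentially] assms(22))
  have "(?bound \<longlongrightarrow> 3 * (variance_const * (Ck * 0)) + 3 * 0 + 3 * (sigma_sq M X t\<^sub>0 - sigma_sq M X t\<^sub>0)\<^sup>2) F"
    unfolding times_divide_eq_right[symmetric, of Ck]
    by (intro tendsto_add tendsto_mult tendsto_const ratio tendsto_power tendsto_diff mean
        tendsto_divide_0[OF tendsto_const nreal])
  then have bound: "((\<lambda>i. ennreal (?bound i)) \<longlongrightarrow> 0) F"
    using tendsto_ennrealI[of ?bound 0 F] by simp
  have "\<forall>\<^sub>F i in F. (\<integral>\<^sup>+\<omega>. ennreal (\<bar>sigma_hat_sq K X (m i) (n i) \<omega> - sigma_sq M X t\<^sub>0\<bar>\<^sup>2) \<partial>M)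
      \<le> ennreal (?bound i)"
    using assms(21)[unfolded filterlim_at_top, rule_format, of 1]
      assms(22)[unfolded filterlim_at_top, rule_format, of 1]
  proof eventually_elim
    case (elim i)
    show ?case
      unfolding mean_def
    proof (rule mean_square_error_le)
      show "(\<Sum>t = 1..int (n i). (K (real_of_int \<bar>s - t\<bar> / m i))\<^sup>2) \<le> Ck * m i" for s
        unfolding Ck_def by (rule kernel_weights_sum_le[OF assms(15,16) elim(1)]) simp
      show "0 < Ck * m i" using Ck assms(20) by simp
    qed (use elim assms(13) in auto)
  qed
  then have "tendsto_in_mean_square M (\<lambda>i. sigma_hat_sq K X (m i) (n i)) (sigma_sq M X t\<^sub>0) F"
    unfolding tendsto_in_mean_square_def
    by (rule tendsto_sandwich[OF always_eventually, rotated 1, OF _ tendsto_const bound]) simp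
  with has show ?thesis
    unfolding summable_on_def by blast
qed

end
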